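(* Let $\gamma\in\mathbb{R}$, let $\psi:\mathbb{N}\to(0,+\infty)$ be monotonic, and assume that the sum $\sum_{n=1}^\infty\psi(n)\log n$ is divergent. Then for almost all $(\alpha,\beta)\in\mathbb{R}^2$ (with respect to Lebesgue measure) the inequality $$\|n\alpha-\gamma\|\,\|n\beta\|<\psi(n)$$ holds for infinitely many $n\in\mathbb{N}$.
   Context: $\|x\|$ denotes the distance from $x\in\mathbb{R}$ to the nearest integer. *)

theory Defs
  imports "HOL-Analysis.Analysis"
begin

definition dist_nearest_int :: "real \<Rightarrow> real" where
  "dist_nearest_int x = infdist x \<int>"

end

theory Submission
  imports Defs "HOL-Library.Discrete_Functions"
begin

text \<open>The proof is a second moment argument in the $(\alpha,\beta)$-plane. If $\psi$ is increasing, it may be replaced by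
the constant $\psi(1)$; so let $\theta \le \psi$ be nonincreasing with $\sum \theta(n) \log n = \infty$.

The region $\|n\alpha-\gamma\|\,\|n\beta\| < \theta(n)$ is bounded by hyperbolas. It contains, for every $j$, the rectangles
$|n\alpha-\gamma-p| < 2^{-j}$, $|n\beta-q| < 2^j\theta(n)$, and for a fixed $j$ these have total area of order $\theta(n)$ in the
unit square. Using the scales $2^j \le \sqrt n$, about $\log n$ of them, recovers the logarithm of the
hypothesis. Two restrictions are imposed. The numerators $q$ are coprime to $n$, and $n$ runs
only through integers for which $\sum_{d \mid n,\, d \ge 2} 1/d \le 9/10$. These have positive density, and for them the
coprime numerators make up a positive proportion of
every interval that is not too short. Let \<open>rect_count\<close> be the number of rectangles with
$n \le N$ that contain a given point. Its mean is of the order of \<open>mass\<close>, which tends to infinity by partial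
summation (\<open>mass_at_top\<close>).

The second moment of \<open>rect_count\<close> is at most a constant times the square of \<open>mass\<close>
(\<open>second_moment_le\<close>). Rectangles belonging to $n$ and $m$ meet only if $mp - nq$ lies in a short interval, and
each value of $mp - nq$ is taken at most $\gcd(n,m)$ times. In the second coordinate reduced fractions
with different denominators are distinct, hence $mp - nq \ne 0$, and different $n$ are quasi-independent
without any error term. In the first coordinate the shift can bring one value of $mp - nq + \gamma(m-n)$ close to
zero, and an error of size $\gcd(n,m) \min(2^{-j}/n, 2^{-h}/m)$ remains. It is harmless on average, because the scales stop at $\sqrt n$ while
$\sum_{m \le M} \gcd(n,m) \le 2M\sqrt n$.

A global second moment bound usually gives only a set of positive measure. For full measure it is combined with a first
moment lower bound in every small box (\<open>rect_count_local_ge\<close>). If \<open>rect_count\<close> stayed bounded on a set of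
positive measure, then boxes that approximate this set closely would carry too little of the mean
(\<open>AE_unbounded_of_second_moment\<close>). This takes the place of a zero-one law. Hence almost every point of the unit square lies in rectangles for infinitely many $n$, and
periodicity extends this to the plane.\<close>

section \<open>Counting pairs of fractions that are close\<close>

lemma card_int_interval_le:
  fixes a b :: real
  assumes "a \<le> b"
  shows "finite {k::int. a < k \<and> k < b}" "real (card {k::int. a < k \<and> k < b}) \<le> b - a + 1"
proof -
  have eq: "{k::int. a < k \<and> k < b} = {\<lfloor>a\<rfloor><..<\<lceil>b\<rceil>}"
    by (auto simp: floor_less_iff less_ceiling_iff)
  show "finite {k::int. a < k \<and> k < b}" unfolding eq by simp
  show "real (card {k::int. a < k \<and> k < b}) \<le> b - a + 1"
    unfolding eq using assms by (simp; linarith)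
qed

lemma card_nonzero_int_le:
  fixes Y :: real
  assumes "0 \<le> Y"
  shows "finite {k::int. k \<noteq> 0 \<and> \<bar>real_of_int k\<bar> < Y}" "real (card {k::int. k \<noteq> 0 \<and> \<bar>real_of_int k\<bar> < Y}) \<le> 2 * Y"
proof -
  have sub: "{k::int. k \<noteq> 0 \<and> \<bar>real_of_int k\<bar> < Y} \<subseteq> {-\<lfloor>Y\<rfloor>..\<lfloor>Y\<rfloor>} - {0}"
    by (auto simp: abs_less_iff) linarith+
  show "finite {k::int. k \<noteq> 0 \<and> \<bar>real_of_int k\<bar> < Y}" by (rule finite_subset[OF sub]) simp
  have "card {k::int. k \<noteq> 0 \<and> \<bar>real_of_int k\<bar> < Y} \<le> card ({-\<lfloor>Y\<rfloor>..\<lfloor>Y\<rfloor>} - {0})"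
    by (rule card_mono[OF _ sub]) simp
  also have "\<dots> = nat (2 * \<lfloor>Y\<rfloor> + 1) - 1" using assms by (simp add: card_Diff_singleton)
  finally show "real (card {k::int. k \<noteq> 0 \<and> \<bar>real_of_int k\<bar> < Y}) \<le> 2 * Y"
    using assms by linarith
qed

text \<open>Two solutions differ in $p$ by a multiple of $n/g$, where $g = \gcd(n,m)$, so $p$ is determined by its
quotient modulo $n/g$, which takes at most $g$ values; $p$ then determines $q$.\<close>

lemma card_solutions_le_gcd:
  fixes n m :: nat and v :: int
  assumes "n > 0" "m > 0"
  shows "card {(p, q). p < n \<and> q < m \<and> int m * int p - int n * int q = v} \<le> gcd n m"
proof -
  let ?g = "gcd n m" and ?P = "{(p, q). p < n \<and> q < m \<and> int m * int p - int n * int q = v}"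
  define n' where "n' = n div ?g"
  define m' where "m' = m div ?g"
  have n: "n = n' * ?g" and m: "m = m' * ?g" unfolding n'_def m'_def by auto
  have g: "?g > 0" using assms by simp
  have n'0: "n' > 0" using assms(1) n by (metis gr0I mult_0 less_irrefl)
  have cop: "coprime n' m'" unfolding n'_def m'_def using assms by (simp add: div_gcd_coprime)
  have "inj_on (\<lambda>(p, q). p div n') ?P"
  proof (rule inj_onI, clarify)
    fix p q p2 q2
    assume e: "int m * int p2 - int n * int q2 = int m * int p - int n * int q" "v = int m * int p - int n * int q"
      and d: "p div n' = p2 div n'"
    have "int m * (int p - int p2) = int n * (int q - int q2)" using e by (simp add: algebra_simps)
    hence "int ?g * (int m' * (int p - int p2)) = int ?g * (int n' * (int q - int q2))"
      by (subst (asm) n, subst (asm) m) (simp add: algebra_simps)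
    hence "int m' * (int p - int p2) = int n' * (int q - int q2)" using g assms by simp
    hence "int n' dvd int m' * (int p - int p2)" by simp
    hence "int n' dvd int p - int p2" using cop by (simp add: coprime_dvd_mult_right_iff)
    hence "int p mod int n' = int p2 mod int n'" by (simp add: mod_eq_dvd_iff)
    hence "p mod n' = p2 mod n'" by (metis of_nat_mod of_nat_eq_iff)
    hence p: "p = p2" using d by (metis div_mult_mod_eq)
    have "q = q2" using e p assms by simp
    thus "p = p2 \<and> q = q2" using p by simp
  qed
  moreover have "(\<lambda>(p, q). p div n') ` ?P \<subseteq> {..<?g}"
    using n n'0 by (auto simp: less_mult_imp_div_less mult.commute)
  ultimately have "card ?P \<le> card {..<?g}" by (intro card_inj_on_le) auto
  thus ?thesis by simp
qed

text \<open>Since $mp - nq$ is always a multiple of the greatest common divisor, counting pairs reduces to counting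
the cofactors $k$; every pair count below goes through this lemma.\<close>

lemma card_pairs_le:
  fixes n m :: nat and K :: "int set"
  assumes "n > 0" "m > 0" "finite K"
    and P: "\<And>p q. (p, q) \<in> P \<Longrightarrow> p < n \<and> q < m \<and> (\<exists>k\<in>K. int m * int p - int n * int q = int (gcd n m) * k)"
  shows "card P \<le> gcd n m * card K"
proof -
  let ?S = "\<lambda>k. {(p, q). p < n \<and> q < m \<and> int m * int p - int n * int q = int (gcd n m) * k}"
  have fin: "finite (?S k)" for k by (rule finite_subset[of _ "{..<n} \<times> {..<m}"]) auto
  have "P \<subseteq> (\<Union>k\<in>K. ?S k)" using P by fastforce
  hence "card P \<le> card (\<Union>k\<in>K. ?S k)" using fin assms(3) by (intro card_mono) auto
  also have "\<dots> \<le> (\<Sum>k\<in>K. card (?S k))" by (rule card_UN_le[OF assms(3)])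
  also have "\<dots> \<le> (\<Sum>k\<in>K. gcd n m)" by (intro sum_mono card_solutions_le_gcd assms)
  finally show ?thesis by (simp add: mult.commute)
qed

lemma gcd_dvd_lincomb: "\<exists>k. int m * int p - int n * int q = int (gcd n m) * k"
proof -
  have "int (gcd n m) dvd int m * int p - int n * int q" 
    by (intro dvd_diff dvd_mult2) (simp_all only: of_nat_dvd_iff gcd_dvd1 gcd_dvd2)
  thus ?thesis by (auto simp: dvd_def)
qed

text \<open>With $\tau = c(m-n)$ this counts the pairs of shifted fractions $(p+c)/n$ and $(q+c)/m$ that are
close to each other. The summand $\gcd(n,m)$ is the price of the single value of $mp - nq$ that may lie
near $-\tau$ even when $X$ is tiny.\<close>

lemma card_close_pairs_le:
  fixes n m :: nat and \<tau> X :: real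
  assumes "n > 0" "m > 0" "0 \<le> X" "Q \<subseteq> {..<n}" "R \<subseteq> {..<m}"
  shows "real (card {(p, q). p \<in> Q \<and> q \<in> R \<and> \<bar>real m * p - real n * q + \<tau>\<bar> < X}) \<le> 2 * X + gcd n m"
    (is "real (card ?P) \<le> _")
proof -
  define g where "g = real (gcd n m)"
  have g: "g > 0" using assms by (simp add: g_def)
  let ?K = "{k::int. (- \<tau> - X) / g < k \<and> k < (- \<tau> + X) / g}"
  have ab: "(- \<tau> - X) / g \<le> (- \<tau> + X) / g" using g assms by (intro divide_right_mono) auto
  note K = card_int_interval_le[OF ab]
  have "card ?P \<le> gcd n m * card ?K"
  proof (rule card_pairs_le[OF assms(1,2) K(1)])
    fix p q assume pq: "(p, q) \<in> ?P"
    obtain k where k: "int m * int p - int n * int q = int (gcd n m) * k" using gcd_dvd_lincomb by blast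
    hence "real_of_int (int m * int p - int n * int q) = real_of_int (int (gcd n m) * k)" by simp
    hence "real m * p - real n * q = g * k" by (simp add: g_def)
    hence "\<bar>g * k + \<tau>\<bar> < X" using pq by simp
    hence "k \<in> ?K" using g by (auto simp: field_simps abs_less_iff)
    thus "p < n \<and> q < m \<and> (\<exists>k\<in>?K. int m * int p - int n * int q = int (gcd n m) * k)"
      using pq k assms(4,5) by blast
  qed
  hence "real (card ?P) \<le> real (gcd n m * card ?K)" by (simp only: of_nat_le_iff)
  also have "\<dots> = g * card ?K" by (simp add: g_def)
  also have "\<dots> \<le> g * ((- \<tau> + X) / g - (- \<tau> - X) / g + 1)" using K(2) g by (intro mult_left_mono) auto
  also have "\<dots> = 2 * X + g" using g by (simp add: field_simps)
  finally show ?thesis by (simp add: g_def)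
qed

definition reduced_numerators :: "nat \<Rightarrow> nat set" where
  "reduced_numerators n = {q. q < n \<and> coprime q n}"

lemma reduced_fractions_distinct:
  assumes "n \<noteq> m" "p \<in> reduced_numerators n" "q \<in> reduced_numerators m"
  shows "m * p \<noteq> n * q"
proof
  assume e: "m * p = n * q"
  have "n dvd m * p" "m dvd n * q" using e by (metis dvd_triv_left)+
  hence "n dvd m" "m dvd n" using assms
    by (simp_all add: reduced_numerators_def coprime_dvd_mult_left_iff coprime_commute)
  thus False using assms by (simp add: dvd_antisym)
qed

text \<open>For reduced fractions with different denominators $mp - nq$ never vanishes, so the error term
$\gcd(n,m)$ of the general count disappears. This is why the numerators in the second coordinate are
taken coprime to $n$.\<close>

lemma card_close_reduced_pairs_le:
  fixes n m :: nat and X :: real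
  assumes "n > 0" "m > 0" "0 \<le> X" "n \<noteq> m"
  shows "real (card {(p, q). p \<in> reduced_numerators n \<and> q \<in> reduced_numerators m \<and> 
      \<bar>real m * p - real n * q\<bar> < X}) \<le> 2 * X"
    (is "real (card ?P) \<le> _")
proof -
  define g where "g = real (gcd n m)"
  have g: "g > 0" using assms by (simp add: g_def)
  let ?K = "{k::int. k \<noteq> 0 \<and> \<bar>real_of_int k\<bar> < X / g}"
  have "0 \<le> X / g" using g assms by simp
  note K = card_nonzero_int_le[OF this]
  have "card ?P \<le> gcd n m * card ?K"
  proof (rule card_pairs_le[OF assms(1,2) K(1)])
    fix p q assume pq: "(p, q) \<in> ?P"
    obtain k where k: "int m * int p - int n * int q = int (gcd n m) * k" using gcd_dvd_lincomb by blast
    hence "real_of_int (int m * int p - int n * int q) = real_of_int (int (gcd n m) * k)" by simp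
    hence "real m * p - real n * q = g * k" by (simp add: g_def)
    hence "\<bar>g * k\<bar> < X" using pq by simp
    hence "\<bar>real_of_int k\<bar> < X / g" using g by (auto simp: field_simps abs_mult)
    moreover have "k \<noteq> 0"
    proof
      assume "k = 0"
      hence "int (m * p) = int (n * q)" using k by simp
      hence "m * p = n * q" by (simp only: of_nat_eq_iff)
      thus False using reduced_fractions_distinct assms pq by blast
    qed
    ultimately show "p < n \<and> q < m \<and> (\<exists>k\<in>?K. int m * int p - int n * int q = int (gcd n m) * k)"
      using pq k by (auto simp: reduced_numerators_def)
  qed
  hence "real (card ?P) \<le> real (gcd n m * card ?K)" by (simp only: of_nat_le_iff)
  also have "\<dots> = g * card ?K" by (simp add: g_def)
  also have "\<dots> \<le> g * (2 * (X / g))" using K(2) g by (intro mult_left_mono) auto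
  also have "\<dots> = 2 * X" using g by (simp add: field_simps)
  finally show ?thesis .
qed

section \<open>Sums of greatest common divisors\<close>

text \<open>Of two complementary divisors $d$ and $n/d$ one is at most $\sqrt n$.\<close>

lemma card_divisors_le:
  fixes n :: nat
  assumes "n > 0"
  shows "real (card {d. d dvd n}) \<le> 2 * sqrt n"
proof -
  let ?s = "floor_sqrt n"
  have "d \<in> {1..?s} \<union> (\<lambda>e. n div e) ` {1..?s}" if d: "d dvd n" for d
  proof (cases "d \<le> ?s")
    case True
    thus ?thesis using d assms by (auto simp: Suc_le_eq dvd_pos_nat)
  next
    case False
    obtain e where e: "n = d * e" using d by auto
    have "e \<le> ?s"
    proof (rule ccontr)
      assume "\<not> e \<le> ?s"
      hence "Suc ?s * Suc ?s \<le> d * e" using False by (intro mult_mono) auto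
      thus False using Suc_floor_sqrt_power2_gt[of n] e by (simp add: power2_eq_square)
    qed
    moreover have "e > 0" using e assms by (cases e) auto
    moreover have "d = n div e" using e \<open>e > 0\<close> by simp
    ultimately show ?thesis by auto
  qed
  hence "card {d. d dvd n} \<le> card ({1..?s} \<union> (\<lambda>e. n div e) ` {1..?s})"
    by (intro card_mono subsetI) simp_all
  also have "\<dots> \<le> card {1..?s} + card ((\<lambda>e. n div e) ` {1..?s})" by (rule card_Un_le)
  also have "\<dots> \<le> ?s + ?s" using card_image_le[of "{1..?s}" "\<lambda>e. n div e"] by simp
  finally have "real (card {d. d dvd n}) \<le> 2 * real ?s" by simp
  also have "real ?s \<le> sqrt n" 
    by (intro real_le_rsqrt) (metis floor_sqrt_power2_le of_nat_le_iff of_nat_power)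
  finally show ?thesis by simp
qed

lemma card_multiples_le:
  fixes d M :: nat
  assumes "d > 0"
  shows "card {m \<in> {1..M}. d dvd m} = M div d"
proof -
  have "{m \<in> {1..M}. d dvd m} = (\<lambda>k. d * k) ` {1..M div d}"
    using assms by (force simp: dvd_def Suc_le_eq less_eq_div_iff_mult_less_eq mult.commute)
  moreover have "inj_on (\<lambda>k. d * k) {1..M div d}" using assms by (intro inj_onI) simp
  ultimately show ?thesis by (simp add: card_image)
qed

text \<open>Bound $\gcd(n,m)$ by the sum of all common divisors $d$; each $d$ contributes $d \lfloor M/d \rfloor \le M$.\<close>

lemma sum_gcd_le:
  fixes n M :: nat
  assumes "n > 0"
  shows "(\<Sum>m=1..M. real (gcd n m)) \<le> M * (2 * sqrt n)"
proof -
  have "(\<Sum>m=1..M. real (gcd n m)) \<le> (\<Sum>m=1..M. \<Sum>d | d dvd n. if d dvd m then real d else 0)"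
  proof (rule sum_mono)
    fix m
    have "real (gcd n m) = (\<Sum>d\<in>{gcd n m}. if d dvd m then real d else 0)" by simp
    also have "\<dots> \<le> (\<Sum>d | d dvd n. if d dvd m then real d else 0)"
      using assms by (intro sum_mono2) auto
    finally show "real (gcd n m) \<le> (\<Sum>d | d dvd n. if d dvd m then real d else 0)" .
  qed
  also have "\<dots> = (\<Sum>d | d dvd n. \<Sum>m=1..M. if d dvd m then real d else 0)" by (rule sum.swap)
  also have "\<dots> \<le> (\<Sum>d | d dvd n. real M)"
  proof (rule sum_mono)
    fix d assume "d \<in> {d. d dvd n}"
    hence d: "d > 0" using assms by (auto simp: dvd_pos_nat)
    have "(\<Sum>m=1..M. if d dvd m then real d else 0) = (\<Sum>m\<in>{m\<in>{1..M}. d dvd m}. real d)"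
      by (simp only: sum.inter_filter finite_atLeastAtMost)
    also have "\<dots> = real (M div d * d)" using card_multiples_le[OF d, of M] by simp
    also have "\<dots> \<le> real M" by (simp only: of_nat_le_iff) simp
    finally show "(\<Sum>m=1..M. if d dvd m then real d else 0) \<le> real M" .
  qed
  also have "\<dots> = real M * real (card {d. d dvd n})" by simp
  also have "\<dots> \<le> M * (2 * sqrt n)" using card_divisors_le[OF assms] by (intro mult_left_mono) auto
  finally show ?thesis .
qed

section \<open>Partial summation\<close>

text \<open>Partial summation: a nonincreasing weight is a positive combination of indicators of initial
segments, so an inequality between all partial sums survives multiplication by it.\<close>

lemma sum_mult_antimono_le:
  fixes \<theta> u v :: "nat \<Rightarrow> real"
  assumes anti: "\<And>m. 1 \<le> m \<Longrightarrow> m < N \<Longrightarrow> \<theta> (Suc m) \<le> \<theta> m"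
    and pos: "\<And>m. 1 \<le> m \<Longrightarrow> m \<le> N \<Longrightarrow> 0 \<le> \<theta> m"
    and le: "\<And>M. 1 \<le> M \<Longrightarrow> M \<le> N \<Longrightarrow> (\<Sum>m=1..M. u m) \<le> (\<Sum>m=1..M. v m)"
  shows "(\<Sum>m=1..N. \<theta> m * u m) \<le> (\<Sum>m=1..N. \<theta> m * v m)"
proof (cases "N = 0")
  case False
  let ?W = "\<lambda>M. \<Sum>m=1..M. v m - u m"
  have "\<theta> M * ?W M \<le> (\<Sum>m=1..M. \<theta> m * (v m - u m))" if "1 \<le> M" "M \<le> N" for M
    using that
  proof (induction M rule: dec_induct)
    case base
    show ?case by simp
  next
    case (step M)
    have W: "0 \<le> ?W M" using le[of M] step by (simp add: sum_subtractf)
    have "\<theta> (Suc M) * ?W (Suc M) = \<theta> (Suc M) * ?W M + \<theta> (Suc M) * (v (Suc M) - u (Suc M))"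
      by (simp add: algebra_simps)
    also have "\<theta> (Suc M) * ?W M \<le> \<theta> M * ?W M"
      using anti[of M] W step by (intro mult_right_mono) auto
    also have "\<theta> M * ?W M \<le> (\<Sum>m=1..M. \<theta> m * (v m - u m))" using step by simp
    finally show ?case by simp
  qed
  from this[of N] have "\<theta> N * ?W N \<le> (\<Sum>m=1..N. \<theta> m * (v m - u m))" using False by simp
  moreover have "0 \<le> \<theta> N * ?W N" using pos[of N] le[of N] False by (simp add: sum_subtractf)
  ultimately show ?thesis by (simp add: right_diff_distrib sum_subtractf)
qed simp

section \<open>Integers with sparse divisors\<close>

text \<open>This is a convenient form of ``$\varphi(n)/n$ is bounded below'': a union bound over the divisors
$d \ge 2$ leaves a tenth of all residues coprime to $n$, and it does so in every interval that is
not too short. Summing over all divisors rather than over the prime ones is crude but enough,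
because $\sum_{d \ge 2} d^{-2} < 9/10$.\<close>

definition divisor_sparse :: "nat \<Rightarrow> bool" where
  "divisor_sparse n \<longleftrightarrow> n \<ge> 1 \<and> (\<Sum>d | d dvd n \<and> 2 \<le> d. 1 / real d) \<le> 9 / 10"

lemma sum_inverse_squares_le: "(\<Sum>d\<in>{2..M::nat}. 1 / (real d)\<^sup>2) \<le> 3 / 4"
proof -
  have "(\<Sum>d\<in>{2..M::nat}. 1 / (real d)\<^sup>2) \<le> 3 / 4 - 1 / M" if "M \<ge> 2" for M
    using that
  proof (induction M rule: dec_induct)
    case base
    show ?case by (simp add: power2_eq_square)
  next
    case (step M)
    have "1 / (real (Suc M))\<^sup>2 \<le> 1 / (real M * real (Suc M))"
      unfolding power2_eq_square using step by (intro divide_left_mono mult_right_mono) auto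
    also have "\<dots> = 1 / M - 1 / Suc M" using step by (simp add: field_simps)
    finally show ?case using step by (simp add: sum.cl_ivl_Suc)
  qed
  note le = this
  show ?thesis
  proof (cases "M \<ge> 2")
    case True
    have "0 \<le> 1 / real M" by simp
    with le[OF True] show ?thesis by linarith
  qed simp
qed

lemma sum_divisor_reciprocals_le: 
  fixes M :: nat
  shows "(\<Sum>n=1..M. \<Sum>d | d dvd n \<and> 2 \<le> d. 1 / real d) \<le> 3 / 4 * M"
proof -
  have "(\<Sum>n=1..M. \<Sum>d | d dvd n \<and> 2 \<le> d. 1 / real d) = (\<Sum>n=1..M. \<Sum>d\<in>{2..M::nat}. if d dvd n then 1 / real d else 0)"
  proof (rule sum.cong[OF refl])
    fix n assume n: "n \<in> {1..M}"
    have "{d. d dvd n \<and> 2 \<le> d} = {d \<in> {2..M}. d dvd n}" using n by (auto dest: dvd_imp_le)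
    thus "(\<Sum>d | d dvd n \<and> 2 \<le> d. 1 / real d) = (\<Sum>d\<in>{2..M::nat}. if d dvd n then 1 / real d else 0)"
      by (simp only: sum.inter_filter finite_atLeastAtMost)
  qed
  also have "\<dots> = (\<Sum>d\<in>{2..M::nat}. \<Sum>n=1..M. if d dvd n then 1 / real d else 0)" by (rule sum.swap)
  also have "\<dots> \<le> (\<Sum>d\<in>{2..M::nat}. M * (1 / (real d)\<^sup>2))"
  proof (rule sum_mono)
    fix d assume d: "d \<in> {2..M}"
    have "(\<Sum>n=1..M. if d dvd n then 1 / real d else 0) = (\<Sum>n\<in>{n\<in>{1..M}. d dvd n}. 1 / real d)"
      by (simp only: sum.inter_filter finite_atLeastAtMost)
    also have "\<dots> = real (M div d) / d" using card_multiples_le[of d M] d by simp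
    also have "\<dots> \<le> (M / d) / d" by (intro divide_right_mono of_nat_div_le_of_nat) auto
    finally show "(\<Sum>n=1..M. if d dvd n then 1 / real d else 0) \<le> M * (1 / (real d)\<^sup>2)"
      by (simp add: power2_eq_square)
  qed
  also have "\<dots> = M * (\<Sum>d\<in>{2..M::nat}. 1 / (real d)\<^sup>2)" by (simp add: sum_distrib_left)
  also have "\<dots> \<le> M * (3 / 4)" by (intro mult_left_mono sum_inverse_squares_le) auto
  finally show ?thesis by simp
qed

text \<open>Markov's inequality: the average of $\sum_{d \mid n,\, d \ge 2} 1/d$ over $n \le M$ is at most $3/4$, so at most
$5M/6$ of these $n$ exceed the threshold $9/10$.\<close>

lemma card_divisor_sparse_ge: "real M / 6 \<le> card {n \<in> {1..M}. divisor_sparse n}"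
proof -
  let ?h = "\<lambda>n::nat. \<Sum>d | d dvd n \<and> 2 \<le> d. 1 / real d"
  let ?G = "{n \<in> {1..M}. divisor_sparse n}" and ?B = "{n \<in> {1..M}. \<not> divisor_sparse n}"
  have "(9/10) * card ?B = (\<Sum>n\<in>?B. 9/10)" by simp
  also have "\<dots> \<le> (\<Sum>n\<in>?B. ?h n)" by (intro sum_mono) (auto simp: divisor_sparse_def)
  also have "\<dots> \<le> (\<Sum>n=1..M. ?h n)" by (intro sum_mono2) (auto intro!: sum_nonneg)
  also have "\<dots> \<le> 3 / 4 * M" by (rule sum_divisor_reciprocals_le)
  finally have "real (card ?B) \<le> 5/6 * M" by simp
  moreover have "card ?G + card ?B = M"
  proof -
    have "{1..M} = ?G \<union> ?B" by auto
    hence "card {1..M} = card ?G + card ?B" by (metis (no_types, lifting) card_Un_disjoint finite_atLeastAtMost finite_Un disjoint_iff mem_Collect_eq)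
    thus ?thesis by simp
  qed
  ultimately show ?thesis by linarith
qed

lemma card_nat_interval:
  fixes x y :: real
  assumes "0 \<le> x" "x \<le> y"
  shows "finite {q::nat. x \<le> q \<and> q \<le> y}" 
    "y - x - 1 \<le> card {q::nat. x \<le> q \<and> q \<le> y}" "card {q::nat. x \<le> q \<and> q \<le> y} \<le> y - x + 1"
proof -
  define a b where "a = \<lceil>x\<rceil>" and "b = \<lfloor>y\<rfloor>"
  have ab: "0 \<le> a" "0 \<le> b" "a \<le> b + 1" using assms unfolding a_def b_def by linarith+
  have eq: "{q::nat. x \<le> q \<and> q \<le> y} = {nat a..nat b}"
    using assms unfolding a_def b_def by (auto simp: nat_le_iff le_nat_iff ceiling_le_iff le_floor_iff)
  show "finite {q::nat. x \<le> q \<and> q \<le> y}" unfolding eq by simp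
  have "int (card {nat a..nat b}) = b + 1 - a" using ab by simp
  hence "real (card {q::nat. x \<le> q \<and> q \<le> y}) = b + 1 - a" unfolding eq by linarith
  moreover have "x \<le> a" "a < x + 1" "b \<le> y" "y < b + 1" unfolding a_def b_def by linarith+
  ultimately show "y - x - 1 \<le> card {q::nat. x \<le> q \<and> q \<le> y}" "card {q::nat. x \<le> q \<and> q \<le> y} \<le> y - x + 1"
    by linarith+
qed

text \<open>Remove from the integers of $[x,y]$ the multiples of each divisor $d \ge 2$ of $n$. The main terms leave at
least $(y-x)/10$, and each of the at most $2\sqrt n$ divisors costs one more for rounding.\<close>

lemma card_reduced_in_interval_ge:
  fixes n :: nat and x y :: real
  assumes "divisor_sparse n" "0 \<le> x" "x \<le> y" "y < n"
  shows "(y - x) / 10 - 2 - 2 * sqrt n \<le> card {q \<in> reduced_numerators n. x \<le> q \<and> q \<le> y}"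
proof -
  let ?A = "{q::nat. x \<le> q \<and> q \<le> y}" and ?D = "{d. d dvd n \<and> 2 \<le> d}"
  have n: "n > 0" using assms by (simp add: divisor_sparse_def)
  note A = card_nat_interval[OF assms(2,3)]
  hence finA: "finite ?A" by blast
  have finD: "finite ?D" using n by (auto intro: finite_subset[of _ "{d. d dvd n}"])
  have mult: "real (card {q \<in> ?A. d dvd q}) \<le> (y - x) / d + 1" if "d \<in> ?D" for d
  proof -
    have d: "real d > 0" using that by simp
    have le: "0 \<le> x / d" "x / d \<le> y / d" using d assms by (auto intro: divide_right_mono)
    have "{q \<in> ?A. d dvd q} \<subseteq> (\<lambda>k. d * k) ` {k::nat. x / d \<le> k \<and> k \<le> y / d}"
    proof
      fix q assume q: "q \<in> {q \<in> ?A. d dvd q}"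
      then obtain k where k: "q = d * k" unfolding dvd_def by blast
      have "x / d \<le> k" "k \<le> y / d" using q d k by (auto simp: field_simps)
      thus "q \<in> (\<lambda>k. d * k) ` {k::nat. x / d \<le> k \<and> k \<le> y / d}" using k by blast
    qed
    hence "card {q \<in> ?A. d dvd q} \<le> card {k::nat. x / d \<le> k \<and> k \<le> y / d}"
      by (rule surj_card_le[OF card_nat_interval(1)[OF le]])
    hence "real (card {q \<in> ?A. d dvd q}) \<le> y / d - x / d + 1"
      using card_nat_interval(3)[OF le] by linarith
    thus ?thesis by (simp add: diff_divide_distrib)
  qed
  define U where "U = (\<Union>d\<in>?D. {q \<in> ?A. d dvd q})"
  let ?R = "{q \<in> reduced_numerators n. x \<le> q \<and> q \<le> y}"
  have "?A - U \<subseteq> ?R"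
  proof
    fix q assume "q \<in> ?A - U"
    hence q: "x \<le> real q" "real q \<le> y" "q \<notin> U" by auto
    have "coprime q n"
    proof (rule ccontr)
      assume "\<not> coprime q n"
      hence "gcd q n \<noteq> 1" by (simp add: coprime_iff_gcd_eq_1)
      moreover have "gcd q n > 0" using n by simp
      ultimately have "2 \<le> gcd q n" by linarith
      hence "q \<in> U" unfolding U_def using q(1,2) by (intro UN_I[of "gcd q n"]) simp_all
      thus False using q by simp
    qed
    thus "q \<in> ?R" using q assms by (simp add: reduced_numerators_def)
  qed
  moreover have "finite ?R" by (simp add: reduced_numerators_def)
  ultimately have "card (?A - U) \<le> card ?R" by (intro card_mono)
  moreover have "finite U" using finA by (rule rev_finite_subset) (auto simp: U_def)
  hence "card ?A - card U \<le> card (?A - U)" by (rule diff_card_le_card_Diff)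
  moreover have "card U \<le> (\<Sum>d\<in>?D. card {q \<in> ?A. d dvd q})"
    unfolding U_def by (rule card_UN_le[OF finD])
  ultimately have "card ?A \<le> card ?R + (\<Sum>d\<in>?D. card {q \<in> ?A. d dvd q})" by linarith
  hence "real (card ?A) \<le> real (card ?R + (\<Sum>d\<in>?D. card {q \<in> ?A. d dvd q}))" by (simp only: of_nat_le_iff)
  hence 1: "real (card ?A) \<le> card ?R + (\<Sum>d\<in>?D. real (card {q \<in> ?A. d dvd q}))" by simp
  have 2: "(\<Sum>d\<in>?D. real (card {q \<in> ?A. d dvd q})) \<le> (\<Sum>d\<in>?D. (y - x) / d + 1)"
    by (rule sum_mono[OF mult])
  have 3: "(\<Sum>d\<in>?D. (y - x) / d + 1) = (y - x) * (\<Sum>d\<in>?D. 1 / d) + card ?D"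
    by (simp add: sum.distrib sum_distrib_left)
  have 4: "(y - x) * (\<Sum>d\<in>?D. 1 / d) \<le> (y - x) * (9 / 10)"
    using assms by (intro mult_left_mono) (auto simp: divisor_sparse_def)
  have "card ?D \<le> card {d. d dvd n}" using n by (intro card_mono) auto
  hence 5: "real (card ?D) \<le> 2 * sqrt n" using card_divisors_le[OF n] by linarith
  define s where "s = (\<Sum>d\<in>?D. real (card {q \<in> ?A. d dvd q}))"
  have "s \<le> (y - x) * (9 / 10) + card ?D"
    unfolding s_def using order_trans[OF 2 eq_refl[OF 3]] 4 by (rule order_trans[OF _ add_right_mono])
  moreover have "(y - x) / 10 - 2 - 2 * t \<le> R"
    if "s \<le> (y - x) * (9 / 10) + D" "y - x - 1 \<le> C" "C \<le> R + s" "D \<le> 2 * t" for C D R t :: real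
    using that by (simp add: field_simps)
  ultimately show ?thesis using A(2) 1[folded s_def] 5 by blast
qed

section \<open>From a second moment bound to almost every point\<close>

text \<open>Cover $Z$ by countably many boxes with pairwise disjoint interiors and little excess, and keep
finitely many of them that carry most of the measure. Open boxes are used so that the result
is disjoint and not just almost disjoint.\<close>

lemma disjoint_boxes_approximate:
  fixes Z :: "'a::euclidean_space set"
  assumes Z: "Z \<in> lmeasurable" "Z \<subseteq> cbox l u" and pos: "0 < measure lebesgue Z" and \<eta>: "0 < \<eta>"
  obtains \<V> where "finite \<V>" "disjoint \<V>" "\<And>V. V \<in> \<V> \<Longrightarrow> \<exists>a b. V = box a b \<and> V \<subseteq> cbox l u"
    "measure lebesgue Z / 2 < (\<Sum>V\<in>\<V>. measure lborel V)" "measure lebesgue (\<Union>\<V> - Z) \<le> \<eta>"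
proof -
  let ?s = "measure lebesgue Z"
  obtain \<D> where D: "countable \<D>"
      "\<And>K. K \<in> \<D> \<Longrightarrow> K \<subseteq> cbox l u \<and> K \<noteq> {} \<and> (\<exists>c d. K = cbox c d)"
      "pairwise (\<lambda>A B. interior A \<inter> interior B = {}) \<D>"
      "Z \<subseteq> \<Union>\<D>" "\<Union>\<D> \<in> lmeasurable" "measure lebesgue (\<Union>\<D>) \<le> ?s + \<eta>"
    using measurable_outer_intervals_bounded[OF Z \<eta>] by metis
  have "\<D> \<noteq> {}" using D(4) pos by auto
  then obtain g :: "nat \<Rightarrow> 'a set" where g: "range g = \<D>"
    using D(1) uncountable_def by blast
  have cb: "\<exists>a b. g i = cbox a b" for i using D(2) g by blast
  have gl: "g i \<in> lmeasurable" for i using cb[of i] by auto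
  have Un: "(\<Union>k. \<Union>i\<le>k. g i) = \<Union>\<D>" using g by auto
  have "(\<lambda>k. measure lebesgue (\<Union>i\<le>k. g i)) \<longlonglongrightarrow> measure lebesgue (\<Union>k. \<Union>i\<le>k. g i)"
  proof (rule Lim_measure_incseq)
    show "range (\<lambda>k. \<Union>i\<le>k. g i) \<subseteq> sets lebesgue" using gl by (auto simp: fmeasurableD)
    show "incseq (\<lambda>k. \<Union>i\<le>k. g i)" by (intro monoI UN_mono) auto
    show "emeasure lebesgue (\<Union>k. \<Union>i\<le>k. g i) \<noteq> \<infinity>" using fmeasurableD2[OF D(5)] Un by simp
  qed
  hence conv: "(\<lambda>k. measure lebesgue (\<Union>i\<le>k. g i)) \<longlonglongrightarrow> measure lebesgue (\<Union>\<D>)" by (simp only: Un)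
  have "?s \<le> measure lebesgue (\<Union>\<D>)"
    using D(4) fmeasurableD[OF Z(1)] D(5) by (rule measure_mono_fmeasurable)
  hence "?s / 2 < measure lebesgue (\<Union>\<D>)" using pos by linarith
  hence "\<forall>\<^sub>F k in sequentially. ?s / 2 < measure lebesgue (\<Union>i\<le>k. g i)"
    by (rule order_tendstoD(1)[OF conv])
  then obtain k where k: "?s / 2 < measure lebesgue (\<Union>i\<le>k. g i)"
    using eventually_happens'[OF sequentially_bot] by blast
  define \<U> where "\<U> = g ` {..k}"
  have U: "finite \<U>" "\<U> \<subseteq> \<D>" using g by (auto simp: \<U>_def)
  have intU: "interior V \<inter> interior W = {}" if "V \<in> \<U>" "W \<in> \<U>" "V \<noteq> W" for V W
    using pairwiseD[OF D(3)] U(2) that by blast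
  have "measure lebesgue (\<Union>\<U>) \<le> (\<Sum>V\<in>\<U>. measure lebesgue V)"
  proof (rule measure_Union_le[OF U(1)])
    fix V assume "V \<in> \<U>"
    then show "V \<in> sets lebesgue" using gl by (auto simp: \<U>_def fmeasurableD)
  qed
  also have "\<dots> = (\<Sum>V\<in>\<U>. measure lborel (interior V))"
  proof (rule sum.cong[OF refl])
    fix V assume "V \<in> \<U>"
    then obtain a b where "V = cbox a b" using D(2) U by blast
    thus "measure lebesgue V = measure lborel (interior V)" 
      by (simp add: interior_cbox measure_lborel_cbox_eq measure_lborel_box_eq)
  qed
  also have "\<dots> = (\<Sum>V\<in>interior ` \<U>. measure lborel V)"
  proof (subst sum.reindex_nontrivial[OF U(1)])
    fix V W assume "V \<in> \<U>" "W \<in> \<U>" "V \<noteq> W" "interior V = interior W"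
    hence "interior V = {}" using intU by blast
    thus "measure lborel (interior V) = 0" by simp
  qed simp
  finally have big: "?s / 2 < (\<Sum>V\<in>interior ` \<U>. measure lborel V)" using k by (simp add: \<U>_def)
  have sub: "\<Union>(interior ` \<U>) - Z \<subseteq> \<Union>\<D> - Z" using U(2) interior_subset by blast
  have DZ: "\<Union>\<D> - Z \<in> lmeasurable" by (intro fmeasurable_Diff D(5) fmeasurableD Z)
  have "\<Union>(interior ` \<U>) - Z \<in> sets lebesgue"
  proof (intro sets.Diff fmeasurableD[OF Z(1)])
    have "open (\<Union>(interior ` \<U>))" by auto
    thus "\<Union>(interior ` \<U>) \<in> sets lebesgue" by (simp add: borel_open)
  qed
  hence "measure lebesgue (\<Union>(interior ` \<U>) - Z) \<le> measure lebesgue (\<Union>\<D> - Z)"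
    using sub DZ by (intro measure_mono_fmeasurable)
  also have "\<dots> = measure lebesgue (\<Union>\<D>) - ?s"
    by (rule measurable_measure_Diff[OF D(5) fmeasurableD[OF Z(1)] D(4)])
  finally have small: "measure lebesgue (\<Union>(interior ` \<U>) - Z) \<le> \<eta>" using D(6) by linarith
  show thesis
  proof (rule that[OF _ _ _ big small])
    show "finite (interior ` \<U>)" using U by simp
    show "disjoint (interior ` \<U>)" unfolding pairwise_image using intU by (auto simp: pairwise_def disjnt_def)
    fix V assume "V \<in> interior ` \<U>"
    then obtain W where W: "W \<in> \<U>" "V = interior W" by blast
    then obtain a b where ab: "W = cbox a b" "W \<subseteq> cbox l u" using D(2) U(2) by blast
    hence "V = box a b" using W by (simp add: interior_cbox)
    moreover have "V \<subseteq> cbox l u" using ab W interior_subset by blast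
    ultimately show "\<exists>a b. V = box a b \<and> V \<subseteq> cbox l u" by blast
  qed
qed

text \<open>On $Z$ the function is at most $M$. Off $Z$ one has $F \le t + F^2/t$, so the part of the integral outside
$Z$ is small as soon as the excess of the boxes over $Z$ is small and $t$ is large compared with the
second moment.\<close>

lemma integral_disjoint_boxes_le:
  fixes F :: "'a::euclidean_space \<Rightarrow> real"
  assumes \<V>: "finite \<V>" "disjoint \<V>" "\<And>V. V \<in> \<V> \<Longrightarrow> V \<in> sets borel" "\<Union>\<V> - Z \<in> lmeasurable"
    and Z: "Z \<in> sets borel" "Z \<in> lmeasurable" "\<And>x. x \<in> Z \<Longrightarrow> F x \<le> M" and M: "0 \<le> M"
    and nonneg: "\<And>x. 0 \<le> F x" and int: "integrable lborel F" and int2: "integrable lborel (\<lambda>x. (F x)\<^sup>2)"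
    and t: "0 < t"
  shows "(\<Sum>V\<in>\<V>. \<integral>x. indicator V x * F x \<partial>lborel) \<le> 
    M * measure lebesgue Z + t * measure lebesgue (\<Union>\<V> - Z) + (\<integral>x. (F x)\<^sup>2 \<partial>lborel) / t"
proof -
  let ?B = "\<Union>\<V> - Z"
  have B: "?B \<in> sets borel" using \<V>(1,3) Z(1) by (intro sets.Diff sets.finite_Union) auto
  have intV: "integrable lborel (\<lambda>x. indicator V x * F x)" if "V \<in> \<V>" for V
    using integrable_mult_indicator[OF _ int, of V] \<V>(3)[OF that] by simp
  have iB: "integrable lborel (indicat_real ?B)" 
    using fmeasurableD2[OF \<V>(4)] B by (simp add: less_top)
  have iZ: "integrable lborel (indicat_real Z)"
    using fmeasurableD2[OF Z(2)] Z(1) by (simp add: less_top)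
  have le: "(\<Sum>V\<in>\<V>. indicator V x * F x) \<le> M * indicat_real Z x + t * indicat_real ?B x + (F x)\<^sup>2 / t" for x
  proof -
    have "disjoint_family_on id \<V>" using \<V>(2) by (simp add: disjoint_family_on_def pairwise_def disjnt_def)
    hence ind: "indicat_real (\<Union>V\<in>\<V>. id V) x = (\<Sum>V\<in>\<V>. indicator (id V) x)"
      by (rule indicator_UN_disjoint[OF \<V>(1)])
    have "(\<Sum>V\<in>\<V>. indicator V x * F x) = (\<Sum>V\<in>\<V>. indicat_real V x) * F x" by (simp add: sum_distrib_right)
    also have "(\<Sum>V\<in>\<V>. indicat_real V x) = indicator (\<Union>\<V>) x"
      using ind by simp
    finally have eq: "(\<Sum>V\<in>\<V>. indicator V x * F x) = indicator (\<Union>\<V>) x * F x" .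
    have sq: "0 \<le> (F x)\<^sup>2 / t" using t by simp
    have "F x \<le> t + (F x)\<^sup>2 / t"
    proof (cases "F x \<le> t")
      case True
      thus ?thesis using sq by linarith
    next
      case False
      hence "F x * t \<le> F x * F x" using nonneg by (intro mult_left_mono) auto
      hence "F x \<le> (F x)\<^sup>2 / t" using t by (simp add: pos_le_divide_eq power2_eq_square)
      thus ?thesis using t by linarith
    qed
    moreover have "F x \<le> M + (F x)\<^sup>2 / t" if "x \<in> Z" using Z(3)[OF that] sq by linarith
    moreover have "0 \<le> M + (F x)\<^sup>2 / t" using M sq by linarith
    ultimately show ?thesis unfolding eq using sq by (simp add: indicator_def)
  qed
  have "(\<Sum>V\<in>\<V>. \<integral>x. indicator V x * F x \<partial>lborel) = (\<integral>x. (\<Sum>V\<in>\<V>. indicator V x * F x) \<partial>lborel)"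
    by (rule Bochner_Integration.integral_sum[symmetric, OF intV])
  also have "\<dots> \<le> (\<integral>x. M * indicat_real Z x + t * indicat_real ?B x + (F x)\<^sup>2 / t \<partial>lborel)"
    by (intro integral_mono le Bochner_Integration.integrable_sum intV Bochner_Integration.integrable_add
        integrable_mult_right integrable_divide iB iZ int2)
  also have "\<dots> = M * measure lborel Z + t * measure lborel ?B + (\<integral>x. (F x)\<^sup>2 \<partial>lborel) / t"
    using iB iZ int2 by simp
  also have "measure lborel Z = measure lebesgue Z" using Z(1) by simp
  also have "measure lborel ?B = measure lebesgue ?B" using B by simp
  finally show ?thesis .
qed

text \<open>A divergence Borel--Cantelli lemma without a zero-one law. If the $F_N$ were bounded by $M$ on a set
$Z$ of positive measure $s$, choose boxes that approximate $Z$. By the local lower bound the integral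
over them is at least of order $s\,T_N$. But it is at most $M s$ plus the contribution of the excess over $Z$,
which by the global second moment bound is a small multiple of $T_N$ when the excess is small. As
$T_N \to \infty$ this is impossible.\<close>

lemma AE_unbounded_of_second_moment:
  fixes F :: "nat \<Rightarrow> 'a::euclidean_space \<Rightarrow> real" and T :: "nat \<Rightarrow> real"
  assumes nonneg: "\<And>N x. 0 \<le> F N x"
    and int: "\<And>N. integrable lborel (F N)" 
    and int2: "\<And>N. integrable lborel (\<lambda>x. (F N x)\<^sup>2)"
    and C: "0 < C" and second: "\<And>N. 1 \<le> T N \<Longrightarrow> (\<integral>x. (F N x)\<^sup>2 \<partial>lborel) \<le> C * (T N)\<^sup>2"
    and lim: "filterlim T at_top sequentially"
    and c: "0 < c" and local: "\<And>a b. box a b \<subseteq> cbox l u \<Longrightarrow> 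
      \<exists>K. \<forall>N. c * measure lborel (box a b) * T N - K \<le> (\<integral>x. indicator (box a b) x * F N x \<partial>lborel)"
  shows "AE x in lborel. x \<in> cbox l u \<longrightarrow> (\<forall>M::real. \<exists>N. M < F N x)"
proof -
  note [measurable] = borel_measurable_integrable[OF int]
  define Z where "Z = (\<lambda>M::nat. {x \<in> cbox l u. \<forall>N. F N x \<le> M})"
  have Zm[measurable]: "Z M \<in> sets borel" for M
    unfolding Z_def by measurable
  have Zsub: "Z M \<subseteq> cbox l u" for M by (auto simp: Z_def)
  have Zl: "Z M \<in> lmeasurable" for M
    by (rule bounded_set_imp_lmeasurable[OF bounded_subset[OF bounded_cbox Zsub]])
       (use Zm[of M] in auto)
  have null: "measure lebesgue (Z M) = 0" for M
  proof (rule ccontr)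
    let ?s = "measure lebesgue (Z M)"
    assume "?s \<noteq> 0"
    hence s: "?s > 0" by (simp add: zero_less_measure_iff)
    \<comment> \<open>With $t = \lambda T_N$ the second moment contributes $C T_N/\lambda$ and the excess $\lambda \eta T_N$;
    both are made equal to $c s T_N/8$, against a lower bound of $c s T_N/2$.\<close>
    define lam where "lam = 8 * C / (c * ?s)"
    have lam: "lam > 0" using C c s by (simp add: lam_def)
    define \<eta> where "\<eta> = c * ?s / (8 * lam)"
    have \<eta>: "\<eta> > 0" using c s lam by (simp add: \<eta>_def)
    obtain \<V> where V: "finite \<V>" "disjoint \<V>" "\<And>V. V \<in> \<V> \<Longrightarrow> \<exists>a b. V = box a b \<and> V \<subseteq> cbox l u"
      "?s / 2 < (\<Sum>V\<in>\<V>. measure lborel V)" "measure lebesgue (\<Union>\<V> - Z M) \<le> \<eta>"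
      using disjoint_boxes_approximate[OF Zl Zsub s \<eta>] by metis
    have Vb: "V \<in> sets borel" if "V \<in> \<V>" for V using V(3)[OF that] by auto
    have "\<Union>\<V> - Z M \<in> sets borel" using V(1) Vb Zm by (intro sets.Diff sets.finite_Union) auto
    hence VZ: "\<Union>\<V> - Z M \<in> lmeasurable"
      by (intro bounded_set_imp_lmeasurable bounded_subset[OF bounded_cbox[of l u]]) (use V(3) in blast, simp)
    have "\<exists>K. \<forall>V\<in>\<V>. \<forall>N. c * measure lborel V * T N - K V \<le> (\<integral>x. indicator V x * F N x \<partial>lborel)"
    proof (intro bchoice ballI)
      fix V assume "V \<in> \<V>"
      then obtain a b where "V = box a b" "V \<subseteq> cbox l u" using V(3) by blast
      thus "\<exists>K. \<forall>N. c * measure lborel V * T N - K \<le> (\<integral>x. indicator V x * F N x \<partial>lborel)"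
        using local by simp
    qed
    then obtain K where K: "\<And>V N. V \<in> \<V> \<Longrightarrow> 
        c * measure lborel V * T N - K V \<le> (\<integral>x. indicator V x * F N x \<partial>lborel)"
      by blast
    have bound: "c * ?s / 4 * T N \<le> M * ?s + (\<Sum>V\<in>\<V>. K V)" if T1: "1 \<le> T N" for N
    proof -
      have t: "0 < lam * T N" using lam T1 by simp
      have "c * (?s / 2) * T N - (\<Sum>V\<in>\<V>. K V) \<le> c * (\<Sum>V\<in>\<V>. measure lborel V) * T N - (\<Sum>V\<in>\<V>. K V)"
        using V(4) c T1 by (intro diff_right_mono mult_right_mono mult_left_mono) auto
      also have "\<dots> = (\<Sum>V\<in>\<V>. c * measure lborel V * T N - K V)"
        by (simp add: sum_subtractf sum_distrib_left sum_distrib_right)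
      also have "\<dots> \<le> (\<Sum>V\<in>\<V>. \<integral>x. indicator V x * F N x \<partial>lborel)"
        by (rule sum_mono[OF K])
      also have "\<dots> \<le> M * ?s + lam * T N * measure lebesgue (\<Union>\<V> - Z M) + (\<integral>x. (F N x)\<^sup>2 \<partial>lborel) / (lam * T N)"
        by (rule integral_disjoint_boxes_le[OF V(1,2) Vb VZ Zm Zl _ _ nonneg int int2 t]) (auto simp: Z_def)
      also have "lam * T N * measure lebesgue (\<Union>\<V> - Z M) \<le> lam * T N * \<eta>"
        using V(5) t by (intro mult_left_mono) auto
      also have "lam * T N * \<eta> = c * ?s / 8 * T N" using lam by (simp add: \<eta>_def)
      also have "(\<integral>x. (F N x)\<^sup>2 \<partial>lborel) / (lam * T N) \<le> C * (T N)\<^sup>2 / (lam * T N)"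
        using second[OF T1] t by (intro divide_right_mono) auto
      also have "C * (T N)\<^sup>2 / (lam * T N) = c * ?s / 8 * T N"
        using C c s T1 by (simp add: lam_def field_simps power2_eq_square)
      finally show ?thesis by (simp add: algebra_simps)
    qed
    have cs: "c * ?s / 4 > 0" using c s by simp
    define R where "R = M * ?s + (\<Sum>V\<in>\<V>. K V)"
    have "\<forall>\<^sub>F N in sequentially. max 1 (R / (c * ?s / 4) + 1) \<le> T N"
      using lim unfolding filterlim_at_top by blast
    then obtain N where "max 1 (R / (c * ?s / 4) + 1) \<le> T N"
      using eventually_happens'[OF sequentially_bot] by blast
    hence N: "1 \<le> T N" "R / (c * ?s / 4) < T N" by linarith+
    from N(2) have "R < T N * (c * ?s / 4)" by (simp only: pos_divide_less_eq[OF cs])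
    with bound[OF N(1), folded R_def] show False by (simp only: mult.commute)
  qed
  have "AE x in lborel. \<forall>M. x \<notin> Z M"
    unfolding AE_all_countable
  proof
    fix M
    have "emeasure lebesgue (Z M) = 0" using emeasure_eq_measure2[OF Zl[of M]] null[of M] by simp
    hence "emeasure lborel (Z M) = 0" by simp
    thus "AE x in lborel. x \<notin> Z M" by (intro AE_not_in) (auto simp: null_sets_def)
  qed
  thus ?thesis
  proof eventually_elim
    case (elim x)
    show ?case
    proof (intro impI allI)
      fix M :: real assume x: "x \<in> cbox l u"
      obtain m :: nat where m: "M \<le> m" using real_arch_simple by blast
      have "\<exists>N. m < F N x" using elim[rule_format, of m] x by (auto simp: Z_def not_le)
      thus "\<exists>N. M < F N x" using m by (meson le_less_trans)
    qed
  qed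
qed

section \<open>Balls around shifted fractions\<close>

lemma tensor_integral:
  fixes f g :: "real \<Rightarrow> real"
  assumes f: "integrable lborel f" and g: "integrable lborel g"
  shows "integrable lborel (\<lambda>z. f (fst z) * g (snd z))" 
    "(\<integral>z. f (fst z) * g (snd z) \<partial>lborel) = (\<integral>x. f x \<partial>lborel) * (\<integral>y. g y \<partial>lborel)"
proof -
  note [measurable] = borel_measurable_integrable[OF f] borel_measurable_integrable[OF g]
  have 1: "integrable (lborel \<Otimes>\<^sub>M lborel) (\<lambda>z. f (fst z) * g (snd z))"
  proof (rule lborel_pair.Fubini_integrable)
    show "(\<lambda>z. f (fst z) * g (snd z)) \<in> borel_measurable (lborel \<Otimes>\<^sub>M lborel)" by measurable
    show "integrable lborel (\<lambda>x. \<integral>y. norm (f (fst (x, y)) * g (snd (x, y))) \<partial>lborel)"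
      using integrable_mult_left[OF integrable_abs[OF f]] by (simp add: abs_mult)
    show "AE x in lborel. integrable lborel (\<lambda>y. f (fst (x, y)) * g (snd (x, y)))"
      using g by simp
  qed
  thus "integrable lborel (\<lambda>z. f (fst z) * g (snd z))" by (simp add: lborel_prod)
  show "(\<integral>z. f (fst z) * g (snd z) \<partial>lborel) = (\<integral>x. f x \<partial>lborel) * (\<integral>y. g y \<partial>lborel)"
    using lborel_pair.integral_fst'[OF 1] by (simp add: lborel_prod)
qed

text \<open>The number of $p \in Q$ with $|nx - c - p| < r$, that is, the number of balls of radius $r/n$ around the
shifted fractions $(p+c)/n$ that contain $x$. Counting with multiplicity on the whole line,
instead of taking the set of such $x$ modulo one, makes integrals additive in $p$ and avoids
wrap-around at the ends of the unit interval.\<close>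

definition bumps :: "nat set \<Rightarrow> real \<Rightarrow> nat \<Rightarrow> real \<Rightarrow> real \<Rightarrow> real" where
  "bumps Q c n r x = (\<Sum>p\<in>Q. indicator {(real p + c - r) / n<..<(real p + c + r) / n} x)"

lemma bumps_nonneg: "0 \<le> bumps Q c n r x"
  by (auto simp: bumps_def intro: sum_nonneg)

lemma fmeasurable_Ioo: "{a<..<b::real} \<in> fmeasurable lborel"
  by (cases "a \<le> b") (auto simp: fmeasurable_def)

lemma integrable_indicator_Ioo: "integrable lborel (indicator {a<..<b::real} :: real \<Rightarrow> real)"
  using fmeasurable_Ioo by (auto simp: fmeasurable_def)

lemma integrable_bumps: "integrable lborel (bumps Q c n r)"
  unfolding bumps_def[abs_def] by (intro Bochner_Integration.integrable_sum integrable_indicator_Ioo)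

lemma bumps_mult:
  "bumps Q c n r x * bumps R c m s x = (\<Sum>p\<in>Q. \<Sum>q\<in>R. indicator
     ({(real p + c - r) / n<..<(real p + c + r) / n} \<inter> {(real q + c - s) / m<..<(real q + c + s) / m}) x)"
  by (simp add: bumps_def sum_product indicator_inter_arith del: Int_greaterThanLessThan)

lemma integrable_bumps_mult: "integrable lborel (\<lambda>x. bumps Q c n r x * bumps R c m s x)"
  unfolding bumps_mult Int_greaterThanLessThan
  by (intro Bochner_Integration.integrable_sum integrable_indicator_Ioo)

text \<open>Two balls can meet only if their centres are closer than $r/n + s/m$, which after multiplication
by $nm$ is the condition in the count; the length of their intersection is at most that of the smaller ball.\<close>

lemma integral_bumps_mult_le:
  fixes n m :: nat and r s :: real
  assumes "n > 0" "m > 0" "0 < r" "0 < s" "finite Q" "finite R"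
  shows "(\<integral>x. bumps Q c n r x * bumps R c m s x \<partial>lborel) \<le> 
    2 * min (r / n) (s / m) * card {(p, q). p \<in> Q \<and> q \<in> R \<and> \<bar>real m * p - real n * q + c * (real m - real n)\<bar> < m * r + n * s}"
proof -
  let ?w = "2 * min (r / n) (s / m)"
  let ?P = "{(p, q). p \<in> Q \<and> q \<in> R \<and> \<bar>real m * p - real n * q + c * (real m - real n)\<bar> < m * r + n * s}"
  let ?I = "\<lambda>p::nat. {(real p + c - r) / n<..<(real p + c + r) / n}" and ?J = "\<lambda>q::nat. {(real q + c - s) / m<..<(real q + c + s) / m}"
  have each: "measure lborel (?I p \<inter> ?J q) \<le> 
      (if \<bar>real m * p - real n * q + c * (real m - real n)\<bar> < m * r + n * s then ?w else 0)" for p q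
  proof (cases "?I p \<inter> ?J q = {}")
    case True
    thus ?thesis using assms by simp
  next
    case False
    then obtain x where x: "(real p + c - r) / n < x" "x < (real p + c + r) / n" "(real q + c - s) / m < x" "x < (real q + c + s) / m"
      by (auto simp del: Int_greaterThanLessThan)
    have "\<bar>n * x - (real p + c)\<bar> < r" "\<bar>m * x - (real q + c)\<bar> < s" using x assms by (auto simp: field_simps abs_less_iff)
    hence "m * \<bar>n * x - (real p + c)\<bar> < m * r" "n * \<bar>m * x - (real q + c)\<bar> < n * s" using assms by auto
    moreover have "real m * p - real n * q + c * (real m - real n) = n * (m * x - (real q + c)) - m * (n * x - (real p + c))"
      by (simp add: algebra_simps)
    moreover have "\<bar>n * (m * x - (real q + c)) - m * (n * x - (real p + c))\<bar> \<le> n * \<bar>m * x - (real q + c)\<bar> + m * \<bar>n * x - (real p + c)\<bar>"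
      by (rule order_trans[OF abs_triangle_ineq4]) (simp add: abs_mult)
    ultimately have close: "\<bar>real m * p - real n * q + c * (real m - real n)\<bar> < m * r + n * s" by linarith
    have "measure lborel (?I p \<inter> ?J q) \<le> measure lborel (?I p)" 
      by (intro measure_mono_fmeasurable) (simp_all add: fmeasurable_Ioo del: Int_greaterThanLessThan)
    also have "measure lborel (?I p) = (real p + c + r) / n - (real p + c - r) / n" 
      using assms by (intro measure_lborel_Ioo divide_right_mono) auto
    also have "\<dots> = 2 * (r / n)" by (simp add: diff_divide_distrib add_divide_distrib)
    finally have 1: "measure lborel (?I p \<inter> ?J q) \<le> 2 * (r / n)" .
    have "measure lborel (?I p \<inter> ?J q) \<le> measure lborel (?J q)" 
      by (intro measure_mono_fmeasurable) (simp_all add: fmeasurable_Ioo del: Int_greaterThanLessThan)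
    also have "measure lborel (?J q) = (real q + c + s) / m - (real q + c - s) / m" 
      using assms by (intro measure_lborel_Ioo divide_right_mono) auto
    also have "\<dots> = 2 * (s / m)" by (simp add: diff_divide_distrib add_divide_distrib)
    finally show ?thesis using 1 close by simp
  qed
  have "(\<integral>x. bumps Q c n r x * bumps R c m s x \<partial>lborel) = (\<Sum>p\<in>Q. \<Sum>q\<in>R. measure lborel (?I p \<inter> ?J q))"
    unfolding bumps_mult Int_greaterThanLessThan
    by (subst Bochner_Integration.integral_sum, intro Bochner_Integration.integrable_sum integrable_indicator_Ioo)
       (subst Bochner_Integration.integral_sum, intro integrable_indicator_Ioo, simp)
  also have "\<dots> \<le> (\<Sum>p\<in>Q. \<Sum>q\<in>R. if \<bar>real m * p - real n * q + c * (real m - real n)\<bar> < m * r + n * s then ?w else 0)"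
    by (intro sum_mono each)
  also have "\<dots> = (\<Sum>z\<in>Q \<times> R. if \<bar>real m * real (fst z) - real n * real (snd z) + c * (real m - real n)\<bar> < m * r + n * s then ?w else 0)"
    by (simp add: sum.cartesian_product case_prod_unfold)
  also have "\<dots> = (\<Sum>z\<in>{z \<in> Q \<times> R. \<bar>real m * real (fst z) - real n * real (snd z) + c * (real m - real n)\<bar> < m * r + n * s}. ?w)"
    using assms by (subst sum.inter_filter) auto
  also have "{z \<in> Q \<times> R. \<bar>real m * real (fst z) - real n * real (snd z) + c * (real m - real n)\<bar> < m * r + n * s} = ?P" by auto
  finally show ?thesis by (simp add: mult.commute)
qed

lemma min_mult_le:
  fixes n m :: nat and r s :: real
  assumes "n > 0" "m > 0" "0 < r" "0 < s"
  shows "min (r / n) (s / m) * (m * r + n * s) \<le> 2 * (r * s)"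
proof -
  have "min (r / n) (s / m) * (m * r) \<le> s / m * (m * r)" using assms by (intro mult_right_mono) auto
  also have "\<dots> = r * s" using assms by simp
  finally have 1: "min (r / n) (s / m) * (m * r) \<le> r * s" .
  have "min (r / n) (s / m) * (n * s) \<le> r / n * (n * s)" using assms by (intro mult_right_mono) auto
  also have "\<dots> = r * s" using assms by simp
  finally have 2: "min (r / n) (s / m) * (n * s) \<le> r * s" .
  show ?thesis using add_mono[OF 1 2] by (simp add: distrib_left)
qed

text \<open>The first summand is twice what independence of the two bump functions would give; the second is
the correlation caused by common divisors of $n$ and $m$.\<close>

lemma integral_bumps_mult_le_gcd:
  fixes n m :: nat and r s :: real
  assumes "n > 0" "m > 0" "0 < r" "0 < s" "Q \<subseteq> {..<n}" "R \<subseteq> {..<m}"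
  shows "(\<integral>x. bumps Q c n r x * bumps R c m s x \<partial>lborel) \<le> 8 * (r * s) + 2 * real (gcd n m) * min (r / n) (s / m)"
proof -
  let ?X = "m * r + n * s" and ?w = "min (r / n) (s / m)"
  have X: "0 \<le> ?X" using assms by simp
  have w: "0 \<le> ?w" using assms by simp
  have fin: "finite Q" "finite R" using assms by (auto intro: finite_subset)
  have "(\<integral>x. bumps Q c n r x * bumps R c m s x \<partial>lborel) \<le> 2 * ?w * 
      real (card {(p, q). p \<in> Q \<and> q \<in> R \<and> \<bar>real m * p - real n * q + c * (real m - real n)\<bar> < ?X})"
    by (rule integral_bumps_mult_le[OF assms(1-4) fin])
  also have "2 * ?w * real (card {(p, q). p \<in> Q \<and> q \<in> R \<and> \<bar>real m * p - real n * q + c * (real m - real n)\<bar> < ?X})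
     \<le> 2 * ?w * (2 * ?X + real (gcd n m))"
    using card_close_pairs_le[OF assms(1,2) X assms(5,6)] w by (intro mult_left_mono) auto
  also have "\<dots> = 4 * (?w * ?X) + 2 * real (gcd n m) * ?w" by (simp add: algebra_simps)
  also have "\<dots> \<le> 4 * (2 * (r * s)) + 2 * real (gcd n m) * ?w"
    by (intro add_right_mono mult_left_mono min_mult_le assms) auto
  finally show ?thesis by simp
qed

lemma integral_reduced_bumps_mult_le:
  fixes n m :: nat and r s :: real
  assumes "n > 0" "m > 0" "0 < r" "0 < s"
  shows "(\<integral>x. bumps (reduced_numerators n) 0 n r x * bumps (reduced_numerators m) 0 m s x \<partial>lborel) 
    \<le> 8 * (r * s) + (if n = m then 2 * min r s else 0)"
proof (cases "n = m")
  case True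
  have sub: "reduced_numerators n \<subseteq> {..<n}" for n by (auto simp: reduced_numerators_def)
  have "2 * real (gcd n n) * min (r / n) (s / n) = 2 * min r s"
    using assms by (auto simp: min_def divide_right_mono field_simps)
  thus ?thesis using integral_bumps_mult_le_gcd[OF assms sub sub, of 0] True by simp
next
  case False
  let ?X = "m * r + n * s" and ?w = "min (r / n) (s / m)"
  have X: "0 \<le> ?X" using assms by simp
  have w: "0 \<le> ?w" using assms by simp
  have fin: "finite (reduced_numerators n)" for n by (simp add: reduced_numerators_def)
  have "(\<integral>x. bumps (reduced_numerators n) 0 n r x * bumps (reduced_numerators m) 0 m s x \<partial>lborel) \<le> 2 * ?w *
      real (card {(p, q). p \<in> reduced_numerators n \<and> q \<in> reduced_numerators m \<and> \<bar>real m * p - real n * q\<bar> < ?X})"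
    using integral_bumps_mult_le[OF assms fin fin, where c = 0] by simp
  also have "2 * ?w * real (card {(p, q). p \<in> reduced_numerators n \<and> q \<in> reduced_numerators m \<and> 
      \<bar>real m * p - real n * q\<bar> < ?X}) \<le> 2 * ?w * (2 * ?X)"
    using card_close_reduced_pairs_le[OF assms(1,2) X False] w by (intro mult_left_mono) auto
  also have "\<dots> = 4 * (?w * ?X)" by (simp add: algebra_simps)
  also have "\<dots> \<le> 4 * (2 * (r * s))"
    by (intro mult_left_mono min_mult_le assms) auto
  finally show ?thesis using False by simp
qed

lemma integral_bumps_local_ge:
  fixes n :: nat and r :: real
  assumes "n > 0" "0 < r" "finite Q" "P \<subseteq> Q"
    and "\<And>p. p \<in> P \<Longrightarrow> u \<le> (real p + c - r) / n \<and> (real p + c + r) / n \<le> v"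
  shows "card P * (2 * r / n) \<le> (\<integral>x. indicator {u<..<v} x * bumps Q c n r x \<partial>lborel)"
proof -
  let ?I = "\<lambda>p::nat. {(real p + c - r) / n<..<(real p + c + r) / n}"
  have "card P * (2 * r / n) = (\<Sum>p\<in>P. measure lborel (?I p))"
  proof -
    have "measure lborel (?I p) = (real p + c + r) / n - (real p + c - r) / n" for p
      using assms by (intro measure_lborel_Ioo divide_right_mono) auto
    moreover have "(real p + c + r) / n - (real p + c - r) / n = 2 * r / n" for p :: nat
      by (simp add: diff_divide_distrib add_divide_distrib)
    ultimately show ?thesis by simp
  qed
  also have "\<dots> = (\<integral>x. (\<Sum>p\<in>P. indicator (?I p) x) \<partial>lborel)"
    by (subst Bochner_Integration.integral_sum, intro integrable_indicator_Ioo, simp)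
  also have "\<dots> \<le> (\<integral>x. indicator {u<..<v} x * bumps Q c n r x \<partial>lborel)"
  proof (rule integral_mono)
    show "integrable lborel (\<lambda>x. \<Sum>p\<in>P. indicat_real (?I p) x)"
      by (intro Bochner_Integration.integrable_sum integrable_indicator_Ioo)
    show "integrable lborel (\<lambda>x. indicator {u<..<v} x * bumps Q c n r x)"
      using integrable_mult_indicator[OF _ integrable_bumps, of "{u<..<v}"] by simp
    fix x
    have "(\<Sum>p\<in>P. indicat_real (?I p) x) = (\<Sum>p\<in>P. indicator {u<..<v} x * indicat_real (?I p) x)"
      using assms(5) by (intro sum.cong[OF refl]) (force simp: indicator_def)
    also have "\<dots> \<le> (\<Sum>p\<in>Q. indicator {u<..<v} x * indicat_real (?I p) x)"
      using assms by (intro sum_mono2) auto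
    finally show "(\<Sum>p\<in>P. indicat_real (?I p) x) \<le> indicator {u<..<v} x * bumps Q c n r x"
      by (simp add: bumps_def sum_distrib_left)
  qed
  finally show ?thesis .
qed

section \<open>Dyadic scales and the total mass\<close>

text \<open>The largest $j$ with $4^j \le n$. The scales $2^j \le \sqrt n$ are as many
as $\log n$ up to a constant, and still coarse enough for the correlations of the first coordinate to
be controlled by $\sum_{m \le M} \gcd(n,m) \le 2 M \sqrt n$.\<close>

definition level :: "nat \<Rightarrow> nat" where
  "level n = floor_log n div 2"

lemma power_level_le: 
  assumes "n \<ge> 1" "j \<le> level n"
  shows "(2::real) ^ j \<le> sqrt n"
proof -
  have "(2::nat) ^ (2 * j) \<le> 2 ^ floor_log n"
    using assms by (intro power_increasing) (auto simp: level_def)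
  also have "\<dots> \<le> n" using assms by (intro floor_log_exp2_le) auto
  finally have "real (2 ^ (2 * j)) \<le> real n" by (simp only: of_nat_le_iff)
  hence "(2 ^ j)\<^sup>2 \<le> real n" by (simp add: power_mult power2_eq_square power_mult_distrib[symmetric])
  thus ?thesis by (rule real_le_rsqrt)
qed

lemma ln_le_level:
  assumes "n \<ge> 1"
  shows "ln (real n) / 2 \<le> level n + 1"
proof -
  have "n < 2 * 2 ^ floor_log n" by (rule floor_log_exp2_gt)
  also have "2 * (2::nat) ^ floor_log n \<le> 2 ^ (2 * (level n + 1))"
    unfolding power_Suc[symmetric] by (intro power_increasing) (auto simp: level_def)
  finally have "real n \<le> real (2 ^ (2 * (level n + 1)))" by (simp only: of_nat_le_iff less_imp_le)
  hence "ln (real n) \<le> ln (2 ^ (2 * (level n + 1)))" using assms by (subst ln_le_cancel_iff) auto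
  also have "\<dots> = real (2 * (level n + 1)) * ln 2" by (simp only: ln_realpow)
  also have "\<dots> \<le> real (2 * (level n + 1)) * 1" using ln_2_less_1 by (intro mult_left_mono) auto
  finally show ?thesis by simp
qed

lemma sum_powers_two: "(\<Sum>j\<le>L. 2 ^ j) = 2 * 2 ^ L - (1::real)"
  by (induction L) auto

lemma sum_level_powers_le: 
  assumes "n \<ge> 1"
  shows "(\<Sum>j\<le>level n. (2::real) ^ j) \<le> 2 * sqrt n"
  using power_level_le[OF assms order_refl] by (simp add: sum_powers_two)

text \<open>The summand is $2^{-|j-k|}$, so each row is bounded by a geometric series and the double sum grows
only linearly.\<close>

lemma sum_min_powers_le:
  "(\<Sum>j\<le>L. \<Sum>k\<le>L. min ((1/2) ^ j) ((1/2) ^ k) * min (2 ^ j) (2 ^ k)) \<le> 3 * (real L + 1)"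
proof (induction L)
  case (Suc L)
  let ?f = "\<lambda>j k::nat. min ((1/2) ^ j) ((1/2) ^ k) * min (2 ^ j) (2 ^ k) :: real"
  have low: "?f j (Suc L) = (1/2) ^ Suc L * 2 ^ j" if "j \<le> L" for j
  proof -
    have "(1/2 :: real) ^ Suc L \<le> (1/2) ^ j" using that by (intro power_decreasing) auto
    moreover have "(2 :: real) ^ j \<le> 2 ^ Suc L" using that by (intro power_increasing) auto
    ultimately show ?thesis by (simp only: min_absorb1 min_absorb2)
  qed
  have sym: "?f j k = ?f k j" for j k by (simp add: min.commute)
  have "(\<Sum>j\<le>L. ?f j (Suc L)) = (1/2) ^ Suc L * (\<Sum>j\<le>L. 2 ^ j)"
    unfolding sum_distrib_left by (intro sum.cong[OF refl] low) auto
  also have "\<dots> \<le> (1/2) ^ Suc L * (2 * 2 ^ L)" unfolding sum_powers_two by (intro mult_left_mono) auto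
  also have "\<dots> = 1" by (simp add: power_one_over)
  finally have side: "(\<Sum>j\<le>L. ?f j (Suc L)) \<le> 1" .
  have diag: "?f (Suc L) (Suc L) = 1" by (simp add: power_one_over)
  have "(\<Sum>j\<le>Suc L. \<Sum>k\<le>Suc L. ?f j k)
      = (\<Sum>j\<le>L. \<Sum>k\<le>L. ?f j k) + (\<Sum>j\<le>L. ?f j (Suc L)) + (\<Sum>k\<le>L. ?f (Suc L) k) + ?f (Suc L) (Suc L)"
    by (simp only: sum.atMost_Suc sum.distrib)
  also have "(\<Sum>k\<le>L. ?f (Suc L) k) = (\<Sum>k\<le>L. ?f k (Suc L))" by (intro sum.cong[OF refl] sym)
  finally show ?case using Suc side diag by simp
qed simp

definition sparse_upto :: "nat \<Rightarrow> nat set" where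
  "sparse_upto N = {n \<in> {1..N}. divisor_sparse n}"

text \<open>Up to constant factors the mean of \<open>rect_count\<close>: each of the scales $j \le$ \<open>level n\<close> contributes rectangles of
total area of order $\theta(n)$.\<close>

definition mass :: "(nat \<Rightarrow> real) \<Rightarrow> nat \<Rightarrow> real" where
  "mass \<theta> N = (\<Sum>n\<in>sparse_upto N. \<theta> n * (real (level n) + 1))"

lemma finite_sparse_upto [simp]: "finite (sparse_upto N)" by (simp add: sparse_upto_def)

lemma sparse_uptoD: "n \<in> sparse_upto N \<Longrightarrow> 1 \<le> n \<and> n \<le> N \<and> divisor_sparse n" by (simp add: sparse_upto_def)

lemma sum_sparse_upto: "(\<Sum>n\<in>sparse_upto N. f n) = (\<Sum>n=1..N. if divisor_sparse n then f n else (0::real))"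
  unfolding sparse_upto_def by (simp only: sum.inter_filter finite_atLeastAtMost)

lemma mass_mono:
  assumes "\<And>n. 1 \<le> n \<Longrightarrow> 0 < \<theta> n" "M \<le> N"
  shows "mass \<theta> M \<le> mass \<theta> N"
  unfolding mass_def
  by (rule sum_mono2) (use assms in \<open>auto simp: sparse_upto_def less_imp_le\<close>)

text \<open>The integers in the sum defining the mass have positive density, so for a nonincreasing
weight restricting to them costs only a constant factor.\<close>

lemma sum_le_mass:
  fixes \<theta> :: "nat \<Rightarrow> real"
  assumes pos: "\<And>n. 1 \<le> n \<Longrightarrow> 0 < \<theta> n" and anti: "\<And>m n. 1 \<le> m \<Longrightarrow> m \<le> n \<Longrightarrow> \<theta> n \<le> \<theta> m"
  shows "(\<Sum>m=1..N. \<theta> m) \<le> 6 * mass \<theta> N"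
proof -
  have "(\<Sum>m=1..N. \<theta> m * 1) \<le> (\<Sum>m=1..N. \<theta> m * (if divisor_sparse m then 6 else 0))"
  proof (rule sum_mult_antimono_le)
    fix M :: nat
    have "(\<Sum>m=1..M. if divisor_sparse m then 6 else (0::real)) = 6 * card (sparse_upto M)"
      unfolding sum_sparse_upto[symmetric] by simp
    thus "(\<Sum>m=1..M. 1) \<le> (\<Sum>m=1..M. if divisor_sparse m then 6 else (0::real))"
      using card_divisor_sparse_ge[of M] by (simp add: sparse_upto_def)
  qed (use pos anti in \<open>auto intro: less_imp_le\<close>)
  also have "\<dots> = (\<Sum>m\<in>sparse_upto N. 6 * \<theta> m)" unfolding sum_sparse_upto by (intro sum.cong) auto
  also have "\<dots> \<le> (\<Sum>m\<in>sparse_upto N. 6 * (\<theta> m * (real (level m) + 1)))"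
  proof (intro sum_mono mult_left_mono)
    fix m assume "m \<in> sparse_upto N"
    hence "0 < \<theta> m" using pos sparse_uptoD by blast
    thus "\<theta> m \<le> \<theta> m * (real (level m) + 1)" by (simp add: mult_le_cancel_left1)
  qed simp
  finally show ?thesis by (simp add: mass_def sum_distrib_left)
qed

text \<open>Partial summation with $\sum_{m \le M} \gcd(n,m) \sqrt m \le \sqrt M \cdot 2M\sqrt n \le 2nM$ for $M \le n$. Here
$\sqrt m$ comes from the widest scale $2^j \le \sqrt m$ in the second coordinate.\<close>

lemma sum_gcd_sqrt_le:
  fixes \<theta> :: "nat \<Rightarrow> real"
  assumes pos: "\<And>n. 1 \<le> n \<Longrightarrow> 0 < \<theta> n" and anti: "\<And>m n. 1 \<le> m \<Longrightarrow> m \<le> n \<Longrightarrow> \<theta> n \<le> \<theta> m"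
  shows "(\<Sum>m=1..n. \<theta> m * (real (gcd n m) * sqrt (real m))) \<le> 12 * real n * mass \<theta> n"
proof -
  have "(\<Sum>m=1..n. \<theta> m * (real (gcd n m) * sqrt (real m))) \<le> (\<Sum>m=1..n. \<theta> m * (2 * real n))"
  proof (rule sum_mult_antimono_le)
    fix M assume M: "1 \<le> M" "M \<le> n"
    have "(\<Sum>m=1..M. real (gcd n m) * sqrt (real m)) \<le> (\<Sum>m=1..M. real (gcd n m) * sqrt (real M))"
      by (intro sum_mono mult_left_mono) auto
    also have "\<dots> = sqrt M * (\<Sum>m=1..M. real (gcd n m))" by (simp add: sum_distrib_left mult.commute)
    also have "\<dots> \<le> sqrt M * (M * (2 * sqrt n))" using M by (intro mult_left_mono sum_gcd_le) auto
    also have "\<dots> \<le> sqrt n * (M * (2 * sqrt n))" using M by (intro mult_right_mono) auto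
    also have "\<dots> = (sqrt n * sqrt n) * (2 * real M)" by (simp only: mult_ac)
    also have "\<dots> = (\<Sum>m=1..M. 2 * real n)" by simp
    finally show "(\<Sum>m=1..M. real (gcd n m) * sqrt (real m)) \<le> (\<Sum>m=1..M. 2 * real n)" .
  qed (use pos anti in \<open>auto intro: less_imp_le\<close>)
  also have "\<dots> = 2 * real n * (\<Sum>m=1..n. \<theta> m)" by (simp add: sum_distrib_left mult.commute)
  also have "\<dots> \<le> 2 * real n * (6 * mass \<theta> n)" by (intro mult_left_mono sum_le_mass pos anti) auto
  finally show ?thesis by simp
qed

text \<open>At least $M/12$ of the chosen integers lie above $M/12$, and for each of them the level is comparable
with $\log M$.\<close>

lemma sum_ln_le_levels:
  "(\<Sum>n=1..M. ln (real n)) \<le> 60 * (\<Sum>n\<in>sparse_upto M. real (level n) + 1)"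
proof (cases "M = 0")
  case False
  let ?H = "{n \<in> sparse_upto M. real M / 12 < n}"
  have "(\<Sum>n=1..M. ln (real n)) \<le> (\<Sum>n=1..M. ln (real M))" by (intro sum_mono) (auto simp: ln_mono)
  also have "\<dots> = real M * ln (real M)" by simp
  also have "\<dots> \<le> 60 * (real (card ?H) * (ln (real M) / 5))"
  proof -
    have "sparse_upto M \<subseteq> ?H \<union> {1..M div 12}" by (auto simp: sparse_upto_def not_less)
    hence "card (sparse_upto M) \<le> card (?H \<union> {1..M div 12})" by (intro card_mono) auto
    also have "\<dots> \<le> card ?H + M div 12" using card_Un_le[of ?H "{1..M div 12}"] by simp
    finally have "real (card (sparse_upto M)) \<le> real (card ?H) + real (M div 12)" by linarith
    moreover have "real (M div 12) \<le> M / 12" by linarith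
    moreover have "real M / 6 \<le> card (sparse_upto M)" using card_divisor_sparse_ge by (simp add: sparse_upto_def)
    ultimately have "real M / 12 \<le> card ?H" by linarith
    hence "real M / 12 * ln (real M) \<le> real (card ?H) * ln (real M)" using False by (intro mult_right_mono) auto
    moreover have "60 * (h * (l / 5)) = 12 * (h * l)" for h l :: real by simp
    ultimately show ?thesis by linarith
  qed
  also have "real (card ?H) * (ln (real M) / 5) = (\<Sum>n\<in>?H. ln (real M) / 5)" by simp
  also have "\<dots> \<le> (\<Sum>n\<in>?H. real (level n) + 1)"
  proof (rule sum_mono)
    fix n assume n: "n \<in> ?H"
    have n1: "n \<ge> 1" using n sparse_uptoD by blast
    have "real M \<le> 12 * n" using n by simp
    hence "ln (real M) \<le> ln (12 * real n)" using False n1 by (subst ln_le_cancel_iff) auto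
    also have "\<dots> = ln 12 + ln (real n)" using n1 by (simp add: ln_mult)
    also have "ln (12::real) \<le> 3"
    proof -
      have "(12::real) \<le> 2 ^ 4 " by simp
      hence "ln (12::real) \<le> ln (2 ^ 4)" by (subst ln_le_cancel_iff) auto
      also have "\<dots> = 4 * ln 2" by (subst ln_realpow) auto
      also have "ln 2 \<le> (25/36::real)" by (rule ln2_le_25_over_36)
      finally show ?thesis by simp
    qed
    finally show "ln (real M) / 5 \<le> real (level n) + 1" using ln_le_level[OF n1] by simp
  qed
  also have "\<dots> \<le> (\<Sum>n\<in>sparse_upto M. real (level n) + 1)" by (intro sum_mono2) auto
  finally show ?thesis by simp
qed (simp add: sparse_upto_def)

text \<open>By partial summation the mass dominates the partial sums of $\theta(n) \log n$; the number of scales is what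
supplies the logarithm.\<close>

lemma mass_at_top:
  fixes \<theta> :: "nat \<Rightarrow> real"
  assumes pos: "\<And>n. 1 \<le> n \<Longrightarrow> 0 < \<theta> n" and anti: "\<And>m n. 1 \<le> m \<Longrightarrow> m \<le> n \<Longrightarrow> \<theta> n \<le> \<theta> m"
    and div: "\<not> summable (\<lambda>n. \<theta> (Suc n) * ln (real (Suc n)))"
  shows "filterlim (mass \<theta>) at_top sequentially"
  unfolding filterlim_at_top eventually_sequentially
proof
  fix B :: real
  have sum_le: "(\<Sum>n=1..N. \<theta> n * ln (real n)) \<le> 60 * mass \<theta> N" for N
  proof -
    have "(\<Sum>n=1..N. \<theta> n * ln (real n)) \<le> (\<Sum>n=1..N. \<theta> n * (60 * (if divisor_sparse n then real (level n) + 1 else 0)))"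
    proof (rule sum_mult_antimono_le)
      fix M
      show "(\<Sum>n=1..M. ln (real n)) \<le> (\<Sum>n=1..M. 60 * (if divisor_sparse n then real (level n) + 1 else 0))"
        unfolding sum_distrib_left[symmetric] sum_sparse_upto[symmetric] by (rule sum_ln_le_levels)
    qed (use pos anti in \<open>auto intro: less_imp_le\<close>)
    also have "\<dots> = 60 * mass \<theta> N"
      unfolding mass_def sum_sparse_upto sum_distrib_left by (intro sum.cong) auto
    finally show ?thesis .
  qed
  have "\<exists>N. B \<le> mass \<theta> N"
  proof (rule ccontr)
    assume "\<not> (\<exists>N. B \<le> mass \<theta> N)"
    hence less: "mass \<theta> N \<le> B" for N by (auto simp: not_le less_imp_le)
    have "summable (\<lambda>n. \<theta> (Suc n) * ln (real (Suc n)))"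
    proof (rule summableI_nonneg_bounded)
      fix n
      show "0 \<le> \<theta> (Suc n) * ln (real (Suc n))" using pos[of "Suc n"] by (intro mult_nonneg_nonneg) auto
      have "(\<Sum>i<n. \<theta> (Suc i) * ln (real (Suc i))) = (\<Sum>i=1..n. \<theta> i * ln (real i))"
        by (simp add: sum.atLeast1_atMost_eq)
      also have "\<dots> \<le> 60 * B" using sum_le[of n] less[of n] by linarith
      finally show "(\<Sum>i<n. \<theta> (Suc i) * ln (real (Suc i))) \<le> 60 * B" .
    qed
    thus False using div by blast
  qed
  then obtain N where N: "B \<le> mass \<theta> N" ..
  show "\<exists>N. \<forall>n\<ge>N. B \<le> mass \<theta> n"
  proof (intro exI allI impI)
    fix n assume "N \<le> n"
    hence "mass \<theta> N \<le> mass \<theta> n" by (intro mass_mono pos)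
    with N show "B \<le> mass \<theta> n" by linarith
  qed
qed

section \<open>Rectangles below the hyperbola and their second moment\<close>

definition rect_index :: "nat \<Rightarrow> (nat \<times> nat) set" where
  "rect_index N = Sigma (sparse_upto N) (\<lambda>n. {..level n})"

text \<open>For the index $(n,j)$ the product of the next two functions counts the rectangles
$|n\alpha - \gamma - p| < 2^{-j}$, $|n\beta - q| < 2^j \theta(n)$ that contain $(\alpha,\beta)$. The widths are balanced so that the
product of the two distances is less than $\theta(n)$ on every rectangle, whatever $j$ is.\<close>

definition alpha_bumps :: "real \<Rightarrow> nat \<times> nat \<Rightarrow> real \<Rightarrow> real" where
  "alpha_bumps \<gamma> i = bumps {..<fst i} \<gamma> (fst i) ((1/2) ^ snd i)"

definition beta_bumps :: "(nat \<Rightarrow> real) \<Rightarrow> nat \<times> nat \<Rightarrow> real \<Rightarrow> real" where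
  "beta_bumps \<theta> i = bumps (reduced_numerators (fst i)) 0 (fst i) (2 ^ snd i * \<theta> (fst i))"

definition rect_count :: "real \<Rightarrow> (nat \<Rightarrow> real) \<Rightarrow> nat \<Rightarrow> real \<times> real \<Rightarrow> real" where
  "rect_count \<gamma> \<theta> N z = (\<Sum>i\<in>rect_index N. alpha_bumps \<gamma> i (fst z) * beta_bumps \<theta> i (snd z))"

lemma finite_rect_index [simp]: "finite (rect_index N)"
  by (auto simp: rect_index_def intro!: finite_SigmaI)

lemma rect_indexD: "i \<in> rect_index N \<Longrightarrow> 1 \<le> fst i \<and> fst i \<le> N \<and> divisor_sparse (fst i) \<and> snd i \<le> level (fst i)"
  using sparse_uptoD by (auto simp: rect_index_def)

lemma sum_rect_index: "(\<Sum>i\<in>rect_index N. f i) = (\<Sum>n\<in>sparse_upto N. \<Sum>j\<le>level n. f (n, j))"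
  using sum.Sigma[of "sparse_upto N" "\<lambda>n. {..level n}" "\<lambda>n j. f (n, j)"]
  by (simp add: rect_index_def)

lemma mass_rect_index: "mass \<theta> N = (\<Sum>i\<in>rect_index N. \<theta> (fst i))"
  unfolding sum_rect_index mass_def by (simp add: algebra_simps)

lemma alpha_bumps_nonneg: "0 \<le> alpha_bumps \<gamma> i x" and beta_bumps_nonneg: "0 \<le> beta_bumps \<theta> i x"
  by (simp_all add: alpha_bumps_def beta_bumps_def bumps_nonneg)

lemma rect_count_nonneg: "0 \<le> rect_count \<gamma> \<theta> N z"
  unfolding rect_count_def by (intro sum_nonneg mult_nonneg_nonneg alpha_bumps_nonneg beta_bumps_nonneg)

lemma integrable_rect_count: "integrable lborel (rect_count \<gamma> \<theta> N)"
  unfolding rect_count_def[abs_def] alpha_bumps_def beta_bumps_def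
  by (intro Bochner_Integration.integrable_sum tensor_integral integrable_bumps)

lemma rect_count_square: "(rect_count \<gamma> \<theta> N z)\<^sup>2 = (\<Sum>i\<in>rect_index N. \<Sum>k\<in>rect_index N.
    (alpha_bumps \<gamma> i (fst z) * alpha_bumps \<gamma> k (fst z)) * (beta_bumps \<theta> i (snd z) * beta_bumps \<theta> k (snd z)))"
  by (simp add: rect_count_def power2_eq_square sum_product mult_ac)

lemma integrable_alpha_bumps_mult: "integrable lborel (\<lambda>x. alpha_bumps \<gamma> i x * alpha_bumps \<gamma> k x)"
  and integrable_beta_bumps_mult: "integrable lborel (\<lambda>x. beta_bumps \<theta> i x * beta_bumps \<theta> k x)"
  by (simp_all add: alpha_bumps_def beta_bumps_def integrable_bumps_mult)

lemma integrable_rect_count_square: "integrable lborel (\<lambda>z. (rect_count \<gamma> \<theta> N z)\<^sup>2)"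
  unfolding rect_count_square
  by (intro Bochner_Integration.integrable_sum tensor_integral integrable_alpha_bumps_mult integrable_beta_bumps_mult)

lemma integral_double_sum:
  fixes g :: "'i \<Rightarrow> 'k \<Rightarrow> 'a \<Rightarrow> real"
  assumes "\<And>i k. integrable M (g i k)"
  shows "(\<integral>z. (\<Sum>i\<in>A. \<Sum>k\<in>B. g i k z) \<partial>M) = (\<Sum>i\<in>A. \<Sum>k\<in>B. \<integral>z. g i k z \<partial>M)"
  by (simp add: Bochner_Integration.integral_sum Bochner_Integration.integrable_sum assms)

lemma integral_rect_count_square: "(\<integral>z. (rect_count \<gamma> \<theta> N z)\<^sup>2 \<partial>lborel) = (\<Sum>i\<in>rect_index N. \<Sum>k\<in>rect_index N.
    (\<integral>x. alpha_bumps \<gamma> i x * alpha_bumps \<gamma> k x \<partial>lborel) * (\<integral>y. beta_bumps \<theta> i y * beta_bumps \<theta> k y \<partial>lborel))"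
  unfolding rect_count_square
  by (subst integral_double_sum, intro tensor_integral integrable_alpha_bumps_mult integrable_beta_bumps_mult)
     (subst tensor_integral(2)[OF integrable_alpha_bumps_mult integrable_beta_bumps_mult], rule refl)

text \<open>The correlation $\gcd(n,m) \min(\delta/n, \delta'/m)$ of the first coordinates times the widths
$\epsilon\epsilon'$ of the second ones, for $\delta = 2^{-j}$ and $\epsilon = 2^j\theta(n)$. Bounding the minimum by the term of the
larger denominator and using $\delta\epsilon = \theta(n)$ gives the expression below. It is not symmetric, and
the overlap of two indices is bounded by the sum over both orders.\<close>

definition gcd_overlap :: "(nat \<Rightarrow> real) \<Rightarrow> nat \<times> nat \<Rightarrow> nat \<times> nat \<Rightarrow> real" where
  "gcd_overlap \<theta> i k = (if fst k \<le> fst i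
     then \<theta> (fst i) / real (fst i) * (real (gcd (fst i) (fst k)) * (2 ^ snd k * \<theta> (fst k))) else 0)"

text \<open>Rectangles of different scales with the same $n$ do overlap; the overlap decays geometrically in the
distance of the scales.\<close>

definition self_overlap :: "(nat \<Rightarrow> real) \<Rightarrow> nat \<times> nat \<Rightarrow> nat \<times> nat \<Rightarrow> real" where
  "self_overlap \<theta> i k = (if fst k = fst i
     then \<theta> (fst i) * (min ((1/2) ^ snd i) ((1/2) ^ snd k) * min (2 ^ snd i) (2 ^ snd k)) else 0)"

text \<open>The product structure separates the coordinates. Expanding the product of the two one-dimensional
bounds gives an independent term, a term with the gcd correlation of the first coordinate, and
terms that are present only for equal denominators.\<close>

lemma pair_overlap_le:
  fixes \<theta> :: "nat \<Rightarrow> real"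
  assumes pos: "\<And>n. 1 \<le> n \<Longrightarrow> 0 < \<theta> n" and n: "1 \<le> fst i" "1 \<le> fst k"
  shows "(\<integral>x. alpha_bumps \<gamma> i x * alpha_bumps \<gamma> k x \<partial>lborel) * (\<integral>y. beta_bumps \<theta> i y * beta_bumps \<theta> k y \<partial>lborel)
    \<le> 64 * (\<theta> (fst i) * \<theta> (fst k)) + 16 * (gcd_overlap \<theta> i k + gcd_overlap \<theta> k i) + 20 * self_overlap \<theta> i k"
proof -
  obtain n j m h where ik: "i = (n, j)" "k = (m, h)" by (cases i, cases k) auto
  have nm: "n > 0" "m > 0" using n ik by auto
  define \<delta> \<delta>' \<epsilon> \<epsilon>' :: real where "\<delta> = (1/2) ^ j" and "\<delta>' = (1/2) ^ h" and "\<epsilon> = 2 ^ j * \<theta> n" and "\<epsilon>' = 2 ^ h * \<theta> m"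
  have \<theta>: "0 < \<theta> n" "0 < \<theta> m" using pos nm by auto
  have p: "0 < \<delta>" "0 < \<delta>'" "0 < \<epsilon>" "0 < \<epsilon>'" using \<theta> by (auto simp: \<delta>_def \<delta>'_def \<epsilon>_def \<epsilon>'_def)
  have d1: "\<delta> \<le> 1" "\<delta>' \<le> 1" by (auto simp: \<delta>_def \<delta>'_def power_le_one)
  have de: "\<delta> * \<epsilon> = \<theta> n" "\<delta>' * \<epsilon>' = \<theta> m" by (auto simp: \<delta>_def \<delta>'_def \<epsilon>_def \<epsilon>'_def power_one_over)
  let ?g = "real (gcd n m)" and ?w = "min (\<delta> / n) (\<delta>' / m)" and ?D = "if n = m then 2 * min \<epsilon> \<epsilon>' else 0"
  have w0: "0 \<le> ?w" using p by auto
  have A: "(\<integral>x. alpha_bumps \<gamma> i x * alpha_bumps \<gamma> k x \<partial>lborel) \<le> 8 * (\<delta> * \<delta>') + 2 * ?g * ?w"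
    unfolding alpha_bumps_def ik fst_conv snd_conv \<delta>_def[symmetric] \<delta>'_def[symmetric]
    by (rule integral_bumps_mult_le_gcd[OF nm p(1,2)]) auto
  have B: "(\<integral>y. beta_bumps \<theta> i y * beta_bumps \<theta> k y \<partial>lborel) \<le> 8 * (\<epsilon> * \<epsilon>') + ?D"
    unfolding beta_bumps_def ik fst_conv snd_conv \<epsilon>_def[symmetric] \<epsilon>'_def[symmetric]
    by (rule integral_reduced_bumps_mult_le[OF nm p(3,4)])
  have "(\<integral>x. alpha_bumps \<gamma> i x * alpha_bumps \<gamma> k x \<partial>lborel) * (\<integral>y. beta_bumps \<theta> i y * beta_bumps \<theta> k y \<partial>lborel)
    \<le> (8 * (\<delta> * \<delta>') + 2 * ?g * ?w) * (8 * (\<epsilon> * \<epsilon>') + ?D)"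
    using p w0 by (intro mult_mono A B Bochner_Integration.integral_nonneg mult_nonneg_nonneg beta_bumps_nonneg) auto
  also have "\<dots> = 64 * ((\<delta> * \<epsilon>) * (\<delta>' * \<epsilon>')) + 16 * (?g * ?w * (\<epsilon> * \<epsilon>')) + (8 * (\<delta> * \<delta>') + 2 * ?g * ?w) * ?D"
    by (simp add: algebra_simps)
  also have "?g * ?w * (\<epsilon> * \<epsilon>') \<le> gcd_overlap \<theta> i k + gcd_overlap \<theta> k i"
  proof -
    have nn: "0 \<le> gcd_overlap \<theta> i k" "0 \<le> gcd_overlap \<theta> k i" using \<theta> by (auto simp: gcd_overlap_def ik)
    show ?thesis
    proof (cases "m \<le> n")
      case True
      have "?g * ?w * (\<epsilon> * \<epsilon>') \<le> ?g * (\<delta> / n) * (\<epsilon> * \<epsilon>')" using p by (intro mult_right_mono mult_left_mono) auto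
      also have "\<dots> = (\<delta> * \<epsilon>) / n * (?g * \<epsilon>')" by simp
      also have "\<dots> = gcd_overlap \<theta> i k" using True by (simp add: gcd_overlap_def ik de \<epsilon>'_def)
      finally show ?thesis using nn by linarith
    next
      case False
      have "?g * ?w * (\<epsilon> * \<epsilon>') \<le> ?g * (\<delta>' / m) * (\<epsilon> * \<epsilon>')" using p by (intro mult_right_mono mult_left_mono) auto
      also have "\<dots> = (\<delta>' * \<epsilon>') / m * (?g * \<epsilon>)" by simp
      also have "\<dots> = gcd_overlap \<theta> k i" using False by (simp add: gcd_overlap_def ik de \<epsilon>_def gcd.commute)
      finally show ?thesis using nn by linarith
    qed
  qed
  also have "(8 * (\<delta> * \<delta>') + 2 * ?g * ?w) * ?D \<le> 20 * self_overlap \<theta> i k"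
  proof (cases "n = m")
    case True
    have "?g * ?w = min \<delta> \<delta>'" using True nm by (auto simp: min_def field_simps)
    moreover have "\<delta> * \<delta>' \<le> min \<delta> \<delta>'" using p d1 by (simp add: mult_left_le mult_left_le_one_le)
    moreover have "2 * ?g * ?w = 2 * (?g * ?w)" by simp
    ultimately have "8 * (\<delta> * \<delta>') + 2 * ?g * ?w \<le> 10 * min \<delta> \<delta>'" by (simp only:)
    hence "(8 * (\<delta> * \<delta>') + 2 * ?g * ?w) * ?D \<le> 10 * min \<delta> \<delta>' * ?D" using p by (intro mult_right_mono) auto
    also have "\<dots> = 20 * (min \<delta> \<delta>' * min \<epsilon> \<epsilon>')" using True by simp
    also have "20 * (min \<delta> \<delta>' * min \<epsilon> \<epsilon>') = 20 * self_overlap \<theta> i k"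
    proof -
      have "min \<epsilon> \<epsilon>' = \<theta> n * min (2 ^ j) (2 ^ h)"
        using True \<theta> by (simp add: \<epsilon>_def \<epsilon>'_def min_mult_distrib_left mult.commute)
      thus ?thesis using True by (simp add: self_overlap_def ik \<delta>_def \<delta>'_def mult_ac)
    qed
    finally show ?thesis .
  qed (simp add: self_overlap_def ik)
  finally show ?thesis by (simp add: de ik)
qed

text \<open>The independent terms sum to the square of the mass. The gcd terms are also bounded by that
square, by the row estimate below. The terms with equal denominators are only of the
order of the mass itself, which is at most its square once the mass is at least one.\<close>

lemma second_moment_le:
  fixes \<theta> :: "nat \<Rightarrow> real"
  assumes pos: "\<And>n. 1 \<le> n \<Longrightarrow> 0 < \<theta> n" and anti: "\<And>m n. 1 \<le> m \<Longrightarrow> m \<le> n \<Longrightarrow> \<theta> n \<le> \<theta> m"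
    and T1: "1 \<le> mass \<theta> N"
  shows "(\<integral>z. (rect_count \<gamma> \<theta> N z)\<^sup>2 \<partial>lborel) \<le> 900 * (mass \<theta> N)\<^sup>2"
proof -
  let ?I = "rect_index N" and ?T = "mass \<theta> N"
  have \<theta>I: "0 < \<theta> (fst i)" if "i \<in> ?I" for i using rect_indexD[OF that] pos by blast
  have main: "(\<Sum>i\<in>?I. \<Sum>k\<in>?I. \<theta> (fst i) * \<theta> (fst k)) = ?T\<^sup>2"
    by (simp add: mass_rect_index power2_eq_square sum_product)
  have row: "(\<Sum>k\<in>?I. gcd_overlap \<theta> i k) \<le> 24 * \<theta> (fst i) * ?T" if i: "i \<in> ?I" for i
  proof -
    define n where "n = fst i"
    have n: "1 \<le> n" "n \<le> N" using rect_indexD[OF i] by (auto simp: n_def)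
    have \<theta>n: "0 < \<theta> n" using pos n by blast
    have "(\<Sum>k\<in>?I. gcd_overlap \<theta> i k) = (\<Sum>m\<in>sparse_upto N. if m \<le> n
        then \<theta> n / real n * (\<theta> m * (real (gcd n m) * (\<Sum>h\<le>level m. 2 ^ h))) else 0)"
      unfolding sum_rect_index gcd_overlap_def n_def[symmetric] fst_conv snd_conv
      by (intro sum.cong refl) (auto simp: sum_distrib_left mult_ac)
    also have "\<dots> = (\<Sum>m\<in>{m \<in> sparse_upto N. m \<le> n}. \<theta> n / real n * (\<theta> m * (real (gcd n m) * (\<Sum>h\<le>level m. 2 ^ h))))"
      by (simp only: sum.inter_filter finite_sparse_upto)
    also have "\<dots> \<le> (\<Sum>m\<in>{m \<in> sparse_upto N. m \<le> n}. \<theta> n / real n * (\<theta> m * (real (gcd n m) * (2 * sqrt (real m)))))"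
    proof (intro sum_mono mult_left_mono)
      fix m assume "m \<in> {m \<in> sparse_upto N. m \<le> n}"
      hence m: "1 \<le> m" using sparse_uptoD by blast
      show "(\<Sum>h\<le>level m. (2::real) ^ h) \<le> 2 * sqrt m" by (rule sum_level_powers_le[OF m])
      show "0 \<le> \<theta> m" using pos m by (simp add: less_imp_le)
    qed (use \<theta>n in auto)
    also have "\<dots> \<le> (\<Sum>m=1..n. \<theta> n / real n * (\<theta> m * (real (gcd n m) * (2 * sqrt (real m)))))"
      by (intro sum_mono2) (use \<theta>n pos in \<open>auto simp: sparse_upto_def less_imp_le intro!: mult_nonneg_nonneg divide_nonneg_nonneg\<close>)
    also have "\<dots> = 2 * \<theta> n / real n * (\<Sum>m=1..n. \<theta> m * (real (gcd n m) * sqrt (real m)))"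
      by (simp add: sum_distrib_left mult_ac)
    also have "\<dots> \<le> 2 * \<theta> n / real n * (12 * real n * mass \<theta> n)"
      using \<theta>n by (intro mult_left_mono sum_gcd_sqrt_le pos anti) auto
    also have "\<dots> = 24 * \<theta> n * mass \<theta> n" using n by simp
    also have "\<dots> \<le> 24 * \<theta> n * ?T" using \<theta>n n by (intro mult_left_mono mass_mono pos) auto
    finally show ?thesis by (simp add: n_def)
  qed
  have "(\<Sum>i\<in>?I. \<Sum>k\<in>?I. gcd_overlap \<theta> i k) \<le> (\<Sum>i\<in>?I. 24 * \<theta> (fst i) * ?T)" by (intro sum_mono row)
  also have "\<dots> = 24 * ?T * (\<Sum>i\<in>?I. \<theta> (fst i))" by (simp add: sum_distrib_left mult_ac)
  also have "\<dots> = 24 * ?T\<^sup>2" by (simp add: mass_rect_index power2_eq_square)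
  finally have gcds: "(\<Sum>i\<in>?I. \<Sum>k\<in>?I. gcd_overlap \<theta> i k) \<le> 24 * ?T\<^sup>2" .
  have gcds': "(\<Sum>i\<in>?I. \<Sum>k\<in>?I. gcd_overlap \<theta> k i) \<le> 24 * ?T\<^sup>2" by (subst sum.swap) (rule gcds)
  have "(\<Sum>i\<in>?I. \<Sum>k\<in>?I. self_overlap \<theta> i k) = (\<Sum>n\<in>sparse_upto N. \<Sum>j\<le>level n. \<Sum>m\<in>sparse_upto N. if m = n then
      (\<Sum>h\<le>level m. \<theta> n * (min ((1/2) ^ j) ((1/2) ^ h) * min (2 ^ j) (2 ^ h))) else 0)"
    unfolding sum_rect_index self_overlap_def fst_conv snd_conv by (intro sum.cong refl) auto
  also have "\<dots> = (\<Sum>n\<in>sparse_upto N. \<theta> n * (\<Sum>j\<le>level n. \<Sum>h\<le>level n. min ((1/2) ^ j) ((1/2) ^ h) * min (2 ^ j) (2 ^ h)))"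
    by (simp add: sum.delta' sum_distrib_left)
  also have "\<dots> \<le> (\<Sum>n\<in>sparse_upto N. \<theta> n * (3 * (real (level n) + 1)))"
    by (intro sum_mono mult_left_mono sum_min_powers_le) (use pos sparse_uptoD in \<open>auto simp: less_imp_le\<close>)
  also have "\<dots> = 3 * ?T" by (simp add: mass_def sum_distrib_left mult_ac)
  also have "\<dots> \<le> 3 * ?T\<^sup>2" using T1 by (simp add: power2_eq_square)
  finally have self: "(\<Sum>i\<in>?I. \<Sum>k\<in>?I. self_overlap \<theta> i k) \<le> 3 * ?T\<^sup>2" .
  have "(\<integral>z. (rect_count \<gamma> \<theta> N z)\<^sup>2 \<partial>lborel) \<le> (\<Sum>i\<in>?I. \<Sum>k\<in>?I.
      64 * (\<theta> (fst i) * \<theta> (fst k)) + 16 * (gcd_overlap \<theta> i k + gcd_overlap \<theta> k i) + 20 * self_overlap \<theta> i k)"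
    unfolding integral_rect_count_square
    by (intro sum_mono pair_overlap_le pos) (use rect_indexD in blast)+
  also have "\<dots> = 64 * (\<Sum>i\<in>?I. \<Sum>k\<in>?I. \<theta> (fst i) * \<theta> (fst k)) 
      + 16 * ((\<Sum>i\<in>?I. \<Sum>k\<in>?I. gcd_overlap \<theta> i k) + (\<Sum>i\<in>?I. \<Sum>k\<in>?I. gcd_overlap \<theta> k i))
      + 20 * (\<Sum>i\<in>?I. \<Sum>k\<in>?I. self_overlap \<theta> i k)"
    by (simp add: sum.distrib sum_distrib_left distrib_left)
  also have "\<dots> \<le> 64 * ?T\<^sup>2 + 16 * (24 * ?T\<^sup>2 + 24 * ?T\<^sup>2) + 20 * (3 * ?T\<^sup>2)"
    unfolding main by (intro add_mono mult_left_mono gcds gcds' self) auto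
  also have "\<dots> \<le> 900 * ?T\<^sup>2" by simp
  finally show ?thesis .
qed

section \<open>Lower bounds in small boxes\<close>

text \<open>An interval of length $v-u$ contains about $n(v-u)$ complete balls. Because $0 \le \gamma < 1$ and the radius is at
most $1/n$, moving the numerators inwards by one on the left and by two on the right keeps the balls inside.\<close>

lemma alpha_bumps_local_ge:
  fixes u v :: real
  assumes \<gamma>: "0 \<le> \<gamma>" "\<gamma> < 1" and uv: "0 \<le> u" "v \<le> 1" and n: "1 \<le> n" "8 \<le> n * (v - u)"
  shows "(1/2) ^ j * (v - u) \<le> (\<integral>x. indicator {u<..<v} x * alpha_bumps \<gamma> (n, j) x \<partial>lborel)"
proof -
  define \<delta> :: real where "\<delta> = (1/2) ^ j"
  have \<delta>: "0 < \<delta>" "\<delta> \<le> 1" by (auto simp: \<delta>_def power_le_one)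
  let ?P = "{p::nat. n * u + 1 \<le> p \<and> p \<le> n * v - 2}"
  have xy: "0 \<le> n * u + 1" "n * u + 1 \<le> n * v - 2" using n uv by (auto simp: algebra_simps)
  have nv: "n * v \<le> n" using uv by (simp add: mult_left_le)
  have "n * (v - u) / 2 \<le> card ?P"
    using card_nat_interval(2)[OF xy] n by (simp add: algebra_simps)
  hence "n * (v - u) / 2 * (2 * \<delta> / n) \<le> card ?P * (2 * \<delta> / n)" using \<delta> by (intro mult_right_mono) auto
  also have "\<dots> \<le> (\<integral>x. indicator {u<..<v} x * bumps {..<n} \<gamma> n \<delta> x \<partial>lborel)"
  proof (rule integral_bumps_local_ge)
    show "?P \<subseteq> {..<n}" using nv by auto
    fix p assume p: "p \<in> ?P"
    have "n * u \<le> p + \<gamma> - \<delta>" "p + \<gamma> + \<delta> \<le> n * v" using p \<gamma> \<delta> by auto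
    thus "u \<le> (real p + \<gamma> - \<delta>) / n \<and> (real p + \<gamma> + \<delta>) / n \<le> v" using n by (simp add: field_simps)
  qed (use n \<delta> in auto)
  also have "n * (v - u) / 2 * (2 * \<delta> / n) = \<delta> * (v - u)" using n by simp
  finally show ?thesis by (simp add: alpha_bumps_def \<delta>_def)
qed

text \<open>The same count with reduced numerators. The widths $2^j\theta(n)$ may be as large as a multiple of $\sqrt n$, so
the numerators are moved inwards by $W\sqrt n$, which is still negligible against $n(v-u)$.\<close>

lemma beta_bumps_local_ge:
  fixes u v W :: real
  assumes uv: "0 \<le> u" "u < v" "v \<le> 1" and n: "divisor_sparse n" 
    and \<epsilon>: "0 < 2 ^ j * \<theta> n" "2 ^ j * \<theta> n \<le> W * sqrt n"
    and large: "20 * (W / 5 + 4) \<le> sqrt n * (v - u)"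
  shows "2 ^ j * \<theta> n * (v - u) / 10 \<le> (\<integral>x. indicator {u<..<v} x * beta_bumps \<theta> (n, j) x \<partial>lborel)"
proof -
  define \<epsilon> where "\<epsilon> = 2 ^ j * \<theta> n"
  define w where "w = W * sqrt n"
  have n1: "1 \<le> n" using n by (simp add: divisor_sparse_def)
  have s1: "1 \<le> sqrt n" using n1 by simp
  have w: "0 < \<epsilon>" "\<epsilon> \<le> w" using \<epsilon> by (auto simp: \<epsilon>_def w_def)
  have "20 * (W / 5 + 4) * sqrt n \<le> sqrt n * (v - u) * sqrt n" using large by (intro mult_right_mono) auto
  also have "\<dots> = (sqrt n * sqrt n) * (v - u)" by (simp only: mult_ac)
  also have "\<dots> = n * (v - u)" by simp
  finally have big: "4 * w + 80 * sqrt n \<le> n * v - n * u" by (simp add: w_def algebra_simps)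
  let ?P = "{q \<in> reduced_numerators n. n * u + w \<le> q \<and> q \<le> n * v - w}"
  have xy: "0 \<le> n * u + w" "n * u + w \<le> n * v - w" using mult_nonneg_nonneg[of "real n" u] uv w big s1 by linarith+
  have "n * v \<le> n" using uv by (simp add: mult_left_le)
  hence yn: "n * v - w < n" using w by linarith
  have "(y - x) / 20 \<le> R" if "(y - w - (x + w)) / 10 - 2 - 2 * t \<le> R" "4 * w + 80 * t \<le> y - x" "1 \<le> t"
    for x y t R :: real using that by (simp add: field_simps)
  from this[OF card_reduced_in_interval_ge[OF n xy yn] big s1]
  have "n * (v - u) / 20 \<le> card ?P" by (simp only: right_diff_distrib)
  hence "n * (v - u) / 20 * (2 * \<epsilon> / n) \<le> card ?P * (2 * \<epsilon> / n)" using w by (intro mult_right_mono) auto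
  also have "\<dots> \<le> (\<integral>x. indicator {u<..<v} x * bumps (reduced_numerators n) 0 n \<epsilon> x \<partial>lborel)"
  proof (rule integral_bumps_local_ge)
    fix q assume q: "q \<in> ?P"
    have "n * u \<le> real q + 0 - \<epsilon>" "real q + 0 + \<epsilon> \<le> n * v" using q w by auto
    thus "u \<le> (real q + 0 - \<epsilon>) / n \<and> (real q + 0 + \<epsilon>) / n \<le> v" using n1 by (simp add: field_simps)
  qed (use n1 w in \<open>auto simp: reduced_numerators_def\<close>)
  also have "n * (v - u) / 20 * (2 * \<epsilon> / n) = \<epsilon> * (v - u) / 10" using n1 by simp
  finally show ?thesis by (simp add: beta_bumps_def \<epsilon>_def)
qed

text \<open>For all large $n$ the rectangles are equidistributed enough to give every box at least a tenth of its
share of the mass; the finitely many remaining $n$ go into the constant $K$.\<close>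

lemma rect_count_local_ge:
  fixes \<theta> :: "nat \<Rightarrow> real" and a b :: "real \<times> real"
  assumes pos: "\<And>n. 1 \<le> n \<Longrightarrow> 0 < \<theta> n" and anti: "\<And>m n. 1 \<le> m \<Longrightarrow> m \<le> n \<Longrightarrow> \<theta> n \<le> \<theta> m"
    and \<gamma>: "0 \<le> \<gamma>" "\<gamma> < 1" and sub: "box a b \<subseteq> cbox (0, 0) (1, 1)"
  shows "\<exists>K. \<forall>N. 1/10 * measure lborel (box a b) * mass \<theta> N - K \<le> 
    (\<integral>z. indicator (box a b) z * rect_count \<gamma> \<theta> N z \<partial>lborel)"
proof (cases "box a b = {}")
  case True
  show ?thesis unfolding True by (intro exI[of _ 0]) simp
next
  case False
  obtain u u' v v' where ab: "a = (u, u')" "b = (v, v')" by (cases a, cases b) auto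
  have box: "box a b = {u<..<v} \<times> {u'<..<v'}" by (auto simp: ab box_def Basis_prod_def)
  have "cbox a b \<subseteq> cbox (0, 0) (1, 1)"
    using closure_minimal[OF sub closed_cbox] False by (simp add: closure_box)
  hence "cbox u v \<times> cbox u' v' \<subseteq> cbox 0 1 \<times> cbox 0 1" by (simp add: ab cbox_Pair_eq)
  moreover have lt: "u < v" "u' < v'" using False by (auto simp: box)
  moreover have "(u, u') \<in> cbox u v \<times> cbox u' v'" "(v, v') \<in> cbox u v \<times> cbox u' v'" using lt by auto
  ultimately have "(u, u') \<in> cbox 0 1 \<times> cbox 0 1" "(v, v') \<in> cbox 0 1 \<times> cbox 0 1" by (metis subsetD)+
  hence bd: "0 \<le> u" "v \<le> 1" "0 \<le> u'" "v' \<le> 1" by auto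
  have meas: "measure lborel (box a b) = (v - u) * (v' - u')"
    using lt by (simp add: ab measure_lborel_box_eq Basis_prod_def)
  define \<mu> where "\<mu> = (v - u) * (v' - u') / 10"
  have \<mu>: "0 \<le> \<mu>" using lt by (simp add: \<mu>_def)
  define W where "W = \<theta> 1"
  \<comment> \<open>Beyond these thresholds the box is long compared with the spacing $1/n$ of the balls, in the
    second coordinate also compared with the margin $W \sqrt n / n$.\<close>
  obtain n1 :: nat where n1: "8 / (v - u) \<le> n1" using real_arch_simple by blast
  obtain n2 :: nat where n2: "(20 * (W / 5 + 4) / (v' - u'))\<^sup>2 \<le> n2" using real_arch_simple by blast
  define n0 where "n0 = max n1 n2"
  have cell: "\<theta> (fst i) * \<mu> - (if fst i \<le> n0 then \<theta> (fst i) * \<mu> else 0) \<le>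
      (\<integral>x. indicator {u<..<v} x * alpha_bumps \<gamma> i x \<partial>lborel) * (\<integral>y. indicator {u'<..<v'} y * beta_bumps \<theta> i y \<partial>lborel)"
    if i: "i \<in> rect_index N" for i N
  proof -
    obtain n j where nj: "i = (n, j)" by (cases i) auto
    have n: "1 \<le> n" "divisor_sparse n" "j \<le> level n" using rect_indexD[OF i] nj by auto
    show ?thesis
    proof (cases "n \<le> n0")
      case True
      have "0 \<le> (\<integral>x. indicator {u<..<v} x * alpha_bumps \<gamma> i x \<partial>lborel) * (\<integral>y. indicator {u'<..<v'} y * beta_bumps \<theta> i y \<partial>lborel)"
        by (intro mult_nonneg_nonneg Bochner_Integration.integral_nonneg alpha_bumps_nonneg beta_bumps_nonneg) auto
      thus ?thesis using True nj by simp
    next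
      case False
      hence big: "real n1 \<le> n" "real n2 \<le> n" by (auto simp: n0_def)
      have "8 / (v - u) \<le> n" using n1 big by linarith
      hence "8 \<le> n * (v - u)" using lt by (simp add: field_simps)
      hence H: "(1/2) ^ j * (v - u) \<le> (\<integral>x. indicator {u<..<v} x * alpha_bumps \<gamma> i x \<partial>lborel)"
        unfolding nj using \<gamma> bd n by (intro alpha_bumps_local_ge)
      have "20 * (W / 5 + 4) / (v' - u') \<le> sqrt n" using n2 big by (intro real_le_rsqrt) linarith
      hence large: "20 * (W / 5 + 4) \<le> sqrt n * (v' - u')" using lt by (simp add: field_simps)
      have \<theta>n: "0 < \<theta> n" using pos n by blast
      have "2 ^ j * \<theta> n \<le> sqrt n * W" unfolding W_def
        using \<theta>n n by (intro mult_mono power_level_le anti) auto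
      hence V: "2 ^ j * \<theta> n * (v' - u') / 10 \<le> (\<integral>y. indicator {u'<..<v'} y * beta_bumps \<theta> i y \<partial>lborel)"
        unfolding nj using bd lt n large \<theta>n by (intro beta_bumps_local_ge[where W = W]) (auto simp: mult.commute)
      have "\<theta> n * \<mu> = ((1/2) ^ j * (v - u)) * (2 ^ j * \<theta> n * (v' - u') / 10)"
        by (simp add: \<mu>_def power_one_over)
      also have "\<dots> \<le> (\<integral>x. indicator {u<..<v} x * alpha_bumps \<gamma> i x \<partial>lborel) * (\<integral>y. indicator {u'<..<v'} y * beta_bumps \<theta> i y \<partial>lborel)"
        using H V lt \<theta>n by (intro mult_mono) (auto intro!: Bochner_Integration.integral_nonneg alpha_bumps_nonneg mult_nonneg_nonneg)
      finally show ?thesis using False nj by simp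
    qed
  qed
  show ?thesis
  proof (intro exI allI)
    fix N
    have int: "integrable lborel (\<lambda>x. indicator {u<..<v} x * alpha_bumps \<gamma> i x)"
        "integrable lborel (\<lambda>y. indicator {u'<..<v'} y * beta_bumps \<theta> i y)" for i
      using integrable_mult_indicator[OF _ integrable_bumps, of "{u<..<v}"]
        integrable_mult_indicator[OF _ integrable_bumps, of "{u'<..<v'}"]
      by (simp_all add: alpha_bumps_def beta_bumps_def)
    have low: "(\<Sum>i\<in>rect_index N. if fst i \<le> n0 then \<theta> (fst i) * \<mu> else 0) \<le> mass \<theta> n0 * \<mu>"
    proof -
      have "(\<Sum>i\<in>rect_index N. if fst i \<le> n0 then \<theta> (fst i) * \<mu> else 0) = (\<Sum>i\<in>{i \<in> rect_index N. fst i \<le> n0}. \<theta> (fst i) * \<mu>)"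
        by (simp only: sum.inter_filter finite_rect_index)
      also have "\<dots> \<le> (\<Sum>i\<in>rect_index n0. \<theta> (fst i) * \<mu>)"
      proof (rule sum_mono2)
        show "{i \<in> rect_index N. fst i \<le> n0} \<subseteq> rect_index n0" by (auto simp: rect_index_def sparse_upto_def)
        fix i assume "i \<in> rect_index n0 - {i \<in> rect_index N. fst i \<le> n0}"
        hence "0 < \<theta> (fst i)" using rect_indexD pos by blast
        thus "0 \<le> \<theta> (fst i) * \<mu>" using \<mu> by simp
      qed simp
      finally show ?thesis by (simp add: mass_rect_index sum_distrib_right)
    qed
    have "1/10 * measure lborel (box a b) * mass \<theta> N - mass \<theta> n0 * \<mu> = mass \<theta> N * \<mu> - mass \<theta> n0 * \<mu>"
      by (simp add: meas \<mu>_def)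
    also have "\<dots> \<le> mass \<theta> N * \<mu> - (\<Sum>i\<in>rect_index N. if fst i \<le> n0 then \<theta> (fst i) * \<mu> else 0)" using low by simp
    also have "\<dots> = (\<Sum>i\<in>rect_index N. \<theta> (fst i) * \<mu> - (if fst i \<le> n0 then \<theta> (fst i) * \<mu> else 0))"
      by (simp only: mass_rect_index sum_distrib_right sum_subtractf)
    also have "\<dots> \<le> (\<Sum>i\<in>rect_index N. (\<integral>x. indicator {u<..<v} x * alpha_bumps \<gamma> i x \<partial>lborel) * (\<integral>y. indicator {u'<..<v'} y * beta_bumps \<theta> i y \<partial>lborel))"
      by (rule sum_mono[OF cell])
    also have "\<dots> = (\<integral>z. (\<Sum>i\<in>rect_index N. (indicator {u<..<v} (fst z) * alpha_bumps \<gamma> i (fst z)) * (indicator {u'<..<v'} (snd z) * beta_bumps \<theta> i (snd z))) \<partial>lborel)"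
      by (subst Bochner_Integration.integral_sum, intro tensor_integral int) (simp only: tensor_integral(2)[OF int])
    also have "\<dots> = (\<integral>z. indicator (box a b) z * rect_count \<gamma> \<theta> N z \<partial>lborel)"
      by (intro Bochner_Integration.integral_cong refl)
         (auto simp: rect_count_def box indicator_times sum_distrib_left mult_ac indicator_def mem_Times_iff)
    finally show "1/10 * measure lborel (box a b) * mass \<theta> N - mass \<theta> n0 * \<mu> 
      \<le> (\<integral>z. indicator (box a b) z * rect_count \<gamma> \<theta> N z \<partial>lborel)" .
  qed
qed

section \<open>Distances to the nearest integer\<close>

lemma dist_nearest_int_nonneg: "0 \<le> dist_nearest_int x"
  by (simp add: dist_nearest_int_def infdist_nonneg)

lemma dist_nearest_int_le: "dist_nearest_int x \<le> \<bar>x - of_int k\<bar>"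
  unfolding dist_nearest_int_def using infdist_le[of "of_int k" \<int> x] by (simp add: dist_real_def)

lemma dist_nearest_int_add_int: "dist_nearest_int (x + of_int k) = dist_nearest_int x"
proof -
  have ne: "(\<int> :: real set) \<noteq> {}" using Ints_0 by blast
  have "dist_nearest_int (y + of_int l) \<le> dist_nearest_int y" for y l
    unfolding dist_nearest_int_def[of y] infdist_notempty[OF ne]
  proof (rule cINF_greatest)
    fix a :: real assume "a \<in> \<int>"
    then obtain m where "a = of_int m" by (auto elim: Ints_cases)
    thus "dist_nearest_int (y + of_int l) \<le> dist y a"
      using dist_nearest_int_le[of "y + of_int l" "m + l"] by (simp add: dist_real_def)
  qed (rule ne)
  from this[of x k] this[of "x + of_int k" "- k"] show ?thesis by simp
qed

text \<open>The conclusion of the theorem at a single point, kept as a predicate of the pair so that it can be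
translated by integer vectors.\<close>

definition approximable :: "real \<Rightarrow> (nat \<Rightarrow> real) \<Rightarrow> real \<times> real \<Rightarrow> bool" where
  "approximable \<gamma> \<theta> z \<longleftrightarrow> infinite {n. n \<ge> 1 \<and> 
      dist_nearest_int (real n * fst z - \<gamma>) * dist_nearest_int (real n * snd z) < \<theta> n}"

lemma bumps_posD:
  assumes "bumps Q c n r x \<noteq> 0" "n > 0"
  obtains p where "p \<in> Q" "\<bar>n * x - c - real p\<bar> < r"
proof -
  obtain p where p: "p \<in> Q" "x \<in> {(real p + c - r) / n<..<(real p + c + r) / n}"
    using assms by (auto simp: bumps_def indicator_def elim!: sum.not_neutral_contains_not_neutral split: if_splits)
  hence "\<bar>n * x - c - real p\<bar> < r" using assms by (auto simp: field_simps abs_less_iff)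
  thus thesis using that p by blast
qed

text \<open>For a fixed $n$ only finitely many rectangles are counted. If the inequality held for finitely many
$n$ only, the count would therefore be bounded.\<close>

lemma approximable_if_unbounded:
  assumes "\<And>M::real. \<exists>N. M < rect_count \<gamma> \<theta> N z"
  shows "approximable \<gamma> \<theta> z"
proof (rule ccontr)
  let ?f = "\<lambda>i. alpha_bumps \<gamma> i (fst z) * beta_bumps \<theta> i (snd z)"
  let ?H = "{n. n \<ge> 1 \<and> dist_nearest_int (real n * fst z - \<gamma>) * dist_nearest_int (real n * snd z) < \<theta> n}"
  assume "\<not> approximable \<gamma> \<theta> z"
  hence fin: "finite ?H" by (simp add: approximable_def)
  have hit: "fst i \<in> ?H" if i: "i \<in> rect_index N" and nz: "?f i \<noteq> 0" for i N
  proof -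
    obtain n j where nj: "i = (n, j)" by (cases i) auto
    have n: "1 \<le> n" using rect_indexD[OF i] nj by auto
    have "bumps {..<n} \<gamma> n ((1/2) ^ j) (fst z) \<noteq> 0" using nz by (auto simp: nj alpha_bumps_def)
    then obtain p where p: "\<bar>n * fst z - \<gamma> - real p\<bar> < (1/2) ^ j" using n by (auto elim: bumps_posD)
    have "bumps (reduced_numerators n) 0 n (2 ^ j * \<theta> n) (snd z) \<noteq> 0" using nz by (auto simp: nj beta_bumps_def)
    then obtain q where q: "\<bar>n * snd z - 0 - real q\<bar> < 2 ^ j * \<theta> n" using n by (auto elim: bumps_posD)
    have "dist_nearest_int (real n * fst z - \<gamma>) < (1/2) ^ j"
      using dist_nearest_int_le[of "real n * fst z - \<gamma>" "int p"] p by simp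
    moreover have "dist_nearest_int (real n * snd z) < 2 ^ j * \<theta> n"
      using dist_nearest_int_le[of "real n * snd z" "int q"] q by simp
    ultimately have "dist_nearest_int (real n * fst z - \<gamma>) * dist_nearest_int (real n * snd z) < (1/2) ^ j * (2 ^ j * \<theta> n)"
      by (intro mult_strict_mono') (auto simp: dist_nearest_int_nonneg)
    thus ?thesis using n by (simp add: nj power_one_over)
  qed
  let ?K = "Sigma ?H (\<lambda>n. {..level n})"
  have finK: "finite ?K" using fin by (intro finite_SigmaI) auto
  have "rect_count \<gamma> \<theta> N z \<le> (\<Sum>i\<in>?K. ?f i)" for N
  proof -
    have "rect_count \<gamma> \<theta> N z = (\<Sum>i\<in>rect_index N \<inter> ?K. ?f i)"
      unfolding rect_count_def
    proof (rule sum.mono_neutral_right)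
      show "\<forall>i\<in>rect_index N - rect_index N \<inter> ?K. ?f i = 0"
      proof
        fix i assume i: "i \<in> rect_index N - rect_index N \<inter> ?K"
        hence "i \<notin> ?K" "snd i \<le> level (fst i)" using rect_indexD by blast+
        hence "fst i \<notin> ?H" by (metis (no_types, lifting) SigmaI atMost_iff prod.collapse)
        thus "?f i = 0" using hit i by blast
      qed
    qed auto
    also have "\<dots> \<le> (\<Sum>i\<in>?K. ?f i)"
      by (intro sum_mono2 finK mult_nonneg_nonneg alpha_bumps_nonneg beta_bumps_nonneg) auto
    finally show ?thesis .
  qed
  thus False using assms[of "\<Sum>i\<in>?K. ?f i"] by (meson not_le)
qed

lemma AE_approximable_unit_square:
  fixes \<theta> :: "nat \<Rightarrow> real"
  assumes pos: "\<And>n. 1 \<le> n \<Longrightarrow> 0 < \<theta> n" and anti: "\<And>m n. 1 \<le> m \<Longrightarrow> m \<le> n \<Longrightarrow> \<theta> n \<le> \<theta> m"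
    and div: "\<not> summable (\<lambda>n. \<theta> (Suc n) * ln (real (Suc n)))"
    and \<gamma>: "0 \<le> \<gamma>" "\<gamma> < 1"
  shows "AE z in lborel. z \<in> cbox (0, 0) (1, 1) \<longrightarrow> approximable \<gamma> \<theta> z"
proof -
  have "AE z in lborel. z \<in> cbox (0, 0) (1, 1) \<longrightarrow> (\<forall>M::real. \<exists>N. M < rect_count \<gamma> \<theta> N z)"
    by (rule AE_unbounded_of_second_moment[where T = "mass \<theta>" and C = 900 and c = "1/10"])
       (intro rect_count_nonneg integrable_rect_count integrable_rect_count_square second_moment_le
         mass_at_top rect_count_local_ge pos anti div \<gamma> | simp)+
  thus ?thesis by eventually_elim (auto intro: approximable_if_unbounded)
qed

lemma approximable_add_int:
  "approximable (\<gamma> + of_int c) \<theta> (z + (of_int a, of_int b)) \<longleftrightarrow> approximable \<gamma> \<theta> z"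
proof -
  have "dist_nearest_int (real n * (fst z + of_int a) - (\<gamma> + of_int c)) = dist_nearest_int (real n * fst z - \<gamma>)" for n
    using dist_nearest_int_add_int[of "real n * fst z - \<gamma>" "int n * a - c"] by (simp add: algebra_simps)
  moreover have "dist_nearest_int (real n * (snd z + of_int b)) = dist_nearest_int (real n * snd z)" for n
    using dist_nearest_int_add_int[of "real n * snd z" "int n * b"] by (simp add: algebra_simps)
  ultimately show ?thesis by (simp add: approximable_def)
qed

text \<open>Translating $(\alpha,\beta)$ by an integer vector, or $\gamma$ by an integer, changes none of the distances to the nearest
integer. So $\gamma$ can be taken in $[0,1)$, and countably many translates of the unit square cover the plane.\<close>

lemma AE_approximable:
  fixes \<theta> :: "nat \<Rightarrow> real"
  assumes pos: "\<And>n. 1 \<le> n \<Longrightarrow> 0 < \<theta> n" and anti: "\<And>m n. 1 \<le> m \<Longrightarrow> m \<le> n \<Longrightarrow> \<theta> n \<le> \<theta> m"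
    and div: "\<not> summable (\<lambda>n. \<theta> (Suc n) * ln (real (Suc n)))"
  shows "AE z in lborel. approximable \<gamma> \<theta> z"
proof -
  have "AE z in lborel. z \<in> cbox (0, 0) (1, 1) \<longrightarrow> approximable (frac \<gamma>) \<theta> z"
    by (rule AE_approximable_unit_square[where \<theta> = \<theta>, OF pos anti div]) (auto simp: frac_lt_1)
  then obtain E where E: "E \<in> null_sets lborel" "{z. \<not> (z \<in> cbox (0, 0) (1, 1) \<longrightarrow> approximable (frac \<gamma>) \<theta> z)} \<subseteq> E"
    by (auto elim!: AE_E simp: null_sets_def)
  have "AE z in lborel. \<forall>w::int \<times> int. z - (of_int (fst w), of_int (snd w)) \<notin> E"
    unfolding AE_all_countable
  proof
    fix w :: "int \<times> int"
    have "{z. z - (of_int (fst w), of_int (snd w)) \<in> E} \<in> null_sets lborel"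
      by (rule null_sets_translation[OF E(1)])
    thus "AE z in lborel. z - (of_int (fst w), of_int (snd w)) \<notin> E" by (rule AE_I') auto
  qed
  thus ?thesis
  proof eventually_elim
    case (elim z)
    define y where "y = (frac (fst z), frac (snd z))"
    have y: "y = z - (of_int \<lfloor>fst z\<rfloor>, of_int \<lfloor>snd z\<rfloor>)"
      by (simp add: y_def frac_def prod_eq_iff)
    have "y \<notin> E" using elim[rule_format, of "(\<lfloor>fst z\<rfloor>, \<lfloor>snd z\<rfloor>)"] y by simp
    moreover have "y \<in> cbox (0, 0) (1, 1)"
      by (simp add: y_def cbox_Pair_eq less_imp_le[OF frac_lt_1])
    ultimately have "approximable (frac \<gamma>) \<theta> y" using E(2) by blast
    hence "approximable (frac \<gamma> + of_int \<lfloor>\<gamma>\<rfloor>) \<theta> (y + (of_int \<lfloor>fst z\<rfloor>, of_int \<lfloor>snd z\<rfloor>))"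
      by (simp only: approximable_add_int)
    thus ?case by (simp add: y frac_def)
  qed
qed

theorem theorem2p3:
  fixes \<gamma> :: real and \<psi> :: "nat \<Rightarrow> real"
  assumes "\<And>n. n \<ge> 1 \<Longrightarrow> \<psi> n > 0"
    and "mono_on {1..} \<psi> \<or> antimono_on {1..} \<psi>"
    and "\<not> summable (\<lambda>n. \<psi> (Suc n) * ln (real (Suc n)))"
  shows "AE (\<alpha>, \<beta>) in (lebesgue :: (real \<times> real) measure).
    infinite {n. n \<ge> 1 \<and>
      dist_nearest_int (real n * \<alpha> - \<gamma>) * dist_nearest_int (real n * \<beta>) < \<psi> n}"
proof -
  obtain \<theta> :: "nat \<Rightarrow> real" where pos: "\<And>n. 1 \<le> n \<Longrightarrow> 0 < \<theta> n" 
    and anti: "\<And>m n. 1 \<le> m \<Longrightarrow> m \<le> n \<Longrightarrow> \<theta> n \<le> \<theta> m"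
    and div: "\<not> summable (\<lambda>n. \<theta> (Suc n) * ln (real (Suc n)))"
    and le: "\<And>n. 1 \<le> n \<Longrightarrow> \<theta> n \<le> \<psi> n"
    using assms(2)
  proof
    assume "antimono_on {1..} \<psi>"
    thus thesis using that[of \<psi>] assms(1,3) by (auto simp: monotone_on_def)
  next
    assume mono: "mono_on {1..} \<psi>"
    show thesis
    proof (rule that[of "\<lambda>_. \<psi> 1"])
      have p1: "0 < \<psi> 1" using assms(1) by simp
      show "\<not> summable (\<lambda>n. \<psi> 1 * ln (real (Suc n)))"
      proof
        assume "summable (\<lambda>n. \<psi> 1 * ln (real (Suc n)))"
        hence "(\<lambda>n. \<psi> 1 * ln (real (Suc n))) \<longlonglongrightarrow> 0" by (rule summable_LIMSEQ_zero)
        moreover have "filterlim (\<lambda>n. \<psi> 1 * ln (real (Suc n))) at_top sequentially"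
          by (intro filterlim_tendsto_pos_mult_at_top[OF tendsto_const p1] filterlim_compose[OF ln_at_top]
              filterlim_compose[OF filterlim_real_sequentially filterlim_Suc])
        ultimately show False using not_tendsto_and_filterlim_at_infinity[of sequentially]
          filterlim_at_top_imp_at_infinity by (metis sequentially_bot)
      qed
    qed (use mono assms(1) in \<open>auto simp: monotone_on_def\<close>)
  qed
  have "AE z in lborel. approximable \<gamma> \<theta> z" by (rule AE_approximable[where \<theta> = \<theta>, OF pos anti div])
  hence "AE z in lborel. approximable \<gamma> \<psi> z"
  proof eventually_elim
    case (elim z)
    thus ?case unfolding approximable_def
      by (rule infinite_super[rotated]) (auto intro!: less_le_trans[OF _ le])
  qed
  hence "AE z in lebesgue. approximable \<gamma> \<psi> z" by (rule AE_completion)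
  thus ?thesis by (simp add: approximable_def case_prod_unfold)
qed

end
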